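(* Let $2\le n<\infty$ and let $E_n'=\operatorname{span}\{I_{n+1},E_{i0},E_{0i}:1\le i\le n\}\subseteq M_{n+1}$. Then the linear map $\theta:\mathcal{S}_n^d\to E_n'$ determined by $\theta(\delta_0)=I_{n+1}$, $\theta(\delta_i)=E_{0i}$, $\theta(\delta_i^* )=E_{i0}$ for $1\le i\le n$ is a complete order isomorphism (a unital linear bijection that is completely positive with completely positive inverse).
   Context: $E_{ij}$, $0\le i,j\le n$, are the matrix units of $M_{n+1}$, and $E_n'$ has the operator system structure inherited from $M_{n+1}$. $\mathcal{O}_n$ is the Cuntz algebra, generated by isometries $S_1,\dots,S_n$ with $\sum_{i=1}^n S_iS_i^*=I$; $\mathcal{S}_n=\operatorname{span}\{I,S_1,\dots,S_n,S_1^*,\dots,S_n^*\}$, with basis $I,S_i,S_i^*$. $\mathcal{S}_n^d$ is the dual space of $\mathcal{S}_n$ with dual basis $\delta_0,\delta_i,\delta_i^*$ ($1\le i\le n$): $\delta_0(I)=1$, $\delta_0(S_j)=\delta_0(S_j^* )=0$; $\delta_i(I)=0$, $\delta_i(S_j)=\delta_{ij}$, $\delta_i(S_j^* )=0$; $\delta_i^*(I)=0$, $\delta_i^*(S_j^* )=\delta_{ij}$, $\delta_i^*(S_j)=0$, where $\delta_{ij}$ is the Kronecker delta. The matrix order on $\mathcal{S}_n^d$ is: $(f_{kl})\in M_p(\mathcal{S}_n^d)^+$ iff the map $\mathcal{S}_n\to M_p$, $x\mapsto(f_{kl}(x))$, is completely positive; with this order and Archimedean order unit $\delta_0$, $\mathcal{S}_n^d$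 is an operator system. *)

theory Defs
  imports Complex_Main "HOL-Library.FuncSet" "Jordan_Normal_Form.Matrix"
begin

text \<open>Unital C*-algebras. Since \<^class>\<open>real_normed_algebra_1\<close> demands
  \<^prop>\<open>norm 1 = 1\<close>, the algebra is nonzero.\<close>

class cstar_algebra = real_normed_algebra_1 + banach +
  fixes scaleC :: "complex \<Rightarrow> 'a \<Rightarrow> 'a"  (infixr \<open>*\<^sub>C\<close> 75)
    and adj :: "'a \<Rightarrow> 'a"
  assumes scaleC_add_right: "c *\<^sub>C (x + y) = c *\<^sub>C x + c *\<^sub>C y"
    and scaleC_add_left: "(c + d) *\<^sub>C x = c *\<^sub>C x + d *\<^sub>C x"
    and scaleC_scaleC: "c *\<^sub>C (d *\<^sub>C x) = (c * d) *\<^sub>C x"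
    and scaleR_scaleC: "r *\<^sub>R x = complex_of_real r *\<^sub>C x"
    and mult_scaleC_left: "(c *\<^sub>C x) * y = c *\<^sub>C (x * y)"
    and mult_scaleC_right: "x * (c *\<^sub>C y) = c *\<^sub>C (x * y)"
    and norm_scaleC: "norm (c *\<^sub>C x) = cmod c * norm x"
    and adj_adj: "adj (adj x) = x"
    and adj_add: "adj (x + y) = adj x + adj y"
    and adj_scaleC: "adj (c *\<^sub>C x) = cnj c *\<^sub>C adj x"
    and adj_mult: "adj (x * y) = adj y * adj x"
    and norm_adj_mult: "norm (adj x * x) = (norm x)\<^sup>2"


text \<open>A matrix ordered vector space with a distinguished unit; \<open>mcone V p\<close> is
  \<open>M\<^sub>p(V)\<^sup>+\<close>. The zero vector is not stored: it is \<open>vsmult V 0 x\<close>. The involution is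
  not stored either: in an operator system the positive elements are selfadjoint and span the
  space, so the cones determine it.\<close>

record 'v op_system =
  carr :: "'v set"
  vadd :: "'v \<Rightarrow> 'v \<Rightarrow> 'v"
  vsmult :: "complex \<Rightarrow> 'v \<Rightarrow> 'v"
  mcone :: "nat \<Rightarrow> 'v mat set"
  vunit :: 'v

definition linear_map :: "'v op_system \<Rightarrow> 'w op_system \<Rightarrow> ('v \<Rightarrow> 'w) \<Rightarrow> bool" where
  "linear_map V W \<phi> \<longleftrightarrow>
     \<phi> \<in> carr V \<rightarrow> carr W \<and>
     (\<forall>x\<in>carr V. \<forall>y\<in>carr V. \<phi> (vadd V x y) = vadd W (\<phi> x) (\<phi> y)) \<and>
     (\<forall>c. \<forall>x\<in>carr V. \<phi> (vsmult V c x) = vsmult W c (\<phi> x))"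

definition completely_positive :: "'v op_system \<Rightarrow> 'w op_system \<Rightarrow> ('v \<Rightarrow> 'w) \<Rightarrow> bool" where
  "completely_positive V W \<phi> \<longleftrightarrow>
     linear_map V W \<phi> \<and> (\<forall>p. \<forall>X\<in>mcone V p. map_mat \<phi> X \<in> mcone W p)"

definition complete_order_iso :: "'v op_system \<Rightarrow> 'w op_system \<Rightarrow> ('v \<Rightarrow> 'w) \<Rightarrow> bool" where
  "complete_order_iso V W \<phi> \<longleftrightarrow>
     bij_betw \<phi> (carr V) (carr W) \<and>
     \<phi> (vunit V) = vunit W \<and>
     completely_positive V W \<phi> \<and>
     completely_positive W V (inv_into (carr V) \<phi>)"

definition subspace_of :: "'v op_system \<Rightarrow> 'v set \<Rightarrow> bool" where
  "subspace_of V U \<longleftrightarrow>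
     U \<subseteq> carr V \<and> U \<noteq> {} \<and>
     (\<forall>x\<in>U. \<forall>y\<in>U. vadd V x y \<in> U) \<and> (\<forall>c. \<forall>x\<in>U. vsmult V c x \<in> U)"

definition span_in :: "'v op_system \<Rightarrow> 'v set \<Rightarrow> 'v set" where
  "span_in V G = subspace_of V hull G"

text \<open>The span of \<open>G\<close> in \<open>V\<close> with the inherited matrix order,
  \<open>M\<^sub>p(U)\<^sup>+ = M\<^sub>p(U) \<inter> M\<^sub>p(V)\<^sup>+\<close>.\<close>

definition subsystem :: "'v op_system \<Rightarrow> 'v set \<Rightarrow> 'v op_system" where
  "subsystem V G =
     V\<lparr> carr := span_in V G,
        mcone := (\<lambda>p. {X \<in> mcone V p. elements_mat X \<subseteq> span_in V G}) \<rparr>"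


definition psd :: "complex mat \<Rightarrow> bool" where
  "psd A \<longleftrightarrow> (\<forall>v\<in>carrier_vec (dim_row A). 0 \<le> (A *\<^sub>v v) \<bullet>c v)"

text \<open>The identification \<open>M\<^sub>p(M\<^sub>m) = M\<^sub>p\<^sub>m\<close>: entry \<open>(k, l)\<close> of block \<open>(i, j)\<close> goes to
  position \<open>(i m + k, j m + l)\<close>.\<close>

definition block_mat :: "nat \<Rightarrow> complex mat mat \<Rightarrow> complex mat" where
  "block_mat m X =
     mat (dim_row X * m) (dim_col X * m)
       (\<lambda>(a, b). (X $$ (a div m, b div m)) $$ (a mod m, b mod m))"

definition matrix_algebra :: "nat \<Rightarrow> complex mat op_system" where
  "matrix_algebra m =
     \<lparr> carr = carrier_mat m m,
       vadd = (+),
       vsmult = (\<cdot>\<^sub>m),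
       mcone = (\<lambda>p. {X \<in> carrier_mat p p.
                 elements_mat X \<subseteq> carrier_mat m m \<and> psd (block_mat m X)}),
       vunit = 1\<^sub>m m \<rparr>"

definition matrix_unit :: "nat \<Rightarrow> nat \<Rightarrow> nat \<Rightarrow> complex mat" where
  "matrix_unit m i j = mat m m (\<lambda>(k, l). if k = i \<and> l = j then 1 else 0)"

definition E' :: "nat \<Rightarrow> complex mat op_system" where
  "E' n = subsystem (matrix_algebra (n + 1))
     ({1\<^sub>m (n + 1)} \<union> (\<lambda>i. matrix_unit (n + 1) i 0) ` {1..n}
                    \<union> (\<lambda>i. matrix_unit (n + 1) 0 i) ` {1..n})"


definition cstar_subalgebra :: "'a::cstar_algebra set \<Rightarrow> bool" where
  "cstar_subalgebra B \<longleftrightarrow>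
     1 \<in> B \<and> closed B \<and>
     (\<forall>x\<in>B. \<forall>y\<in>B. x + y \<in> B \<and> x * y \<in> B) \<and>
     (\<forall>x\<in>B. adj x \<in> B \<and> (\<forall>c. c *\<^sub>C x \<in> B))"

definition adj_mat :: "'a::cstar_algebra mat \<Rightarrow> 'a mat" where
  "adj_mat X = map_mat adj (transpose_mat X)"

text \<open>A C*-subalgebra with its matrix order: the positive elements of the C*-algebra
  \<open>M\<^sub>p(B)\<close> are those of the form \<open>Y\<^sup>* Y\<close> with \<open>Y\<close> in \<open>M\<^sub>p(B)\<close>.\<close>

definition cstar_system :: "'a::cstar_algebra set \<Rightarrow> 'a op_system" where
  "cstar_system B =
     \<lparr> carr = B,
       vadd = (+),
       vsmult = (*\<^sub>C),
       mcone = (\<lambda>p. {adj_mat Y * Y | Y. Y \<in> carrier_mat p p \<and> elements_mat Y \<subseteq> B}),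
       vunit = 1 \<rparr>"

definition cuntz_isometries :: "nat \<Rightarrow> (nat \<Rightarrow> 'a::cstar_algebra) \<Rightarrow> bool" where
  "cuntz_isometries n S \<longleftrightarrow>
     (\<forall>i\<in>{1..n}. adj (S i) * S i = 1) \<and> (\<Sum>i=1..n. S i * adj (S i)) = 1"

text \<open>\<open>O\<^sub>n\<close>, realised as the C*-algebra generated by a given family of Cuntz isometries
  inside any unital C*-algebra (by Cuntz's theorem it does not depend on the family).\<close>

definition cuntz_algebra :: "nat \<Rightarrow> (nat \<Rightarrow> 'a::cstar_algebra) \<Rightarrow> 'a set" where
  "cuntz_algebra n S = cstar_subalgebra hull (S ` {1..n})"

definition cuntz_system :: "nat \<Rightarrow> (nat \<Rightarrow> 'a::cstar_algebra) \<Rightarrow> 'a op_system" where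
  "cuntz_system n S = subsystem (cstar_system (cuntz_algebra n S))
     ({1} \<union> S ` {1..n} \<union> (\<lambda>i. adj (S i)) ` {1..n})"


text \<open>Functionals on \<open>V\<close> are functions on the ambient type that are \<open>undefined\<close> off
  the carrier, so that equality of functions is equality of functionals.\<close>

definition dual_space :: "'v op_system \<Rightarrow> ('v \<Rightarrow> complex) set" where
  "dual_space V = {f \<in> extensional (carr V).
     (\<forall>x\<in>carr V. \<forall>y\<in>carr V. f (vadd V x y) = f x + f y) \<and>
     (\<forall>c. \<forall>x\<in>carr V. f (vsmult V c x) = c * f x)}"

definition dual_system :: "'v op_system \<Rightarrow> ('v \<Rightarrow> complex) \<Rightarrow> ('v \<Rightarrow> complex) op_system" where
  "dual_system V e =
     \<lparr> carr = dual_space V,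
       vadd = (\<lambda>f g. \<lambda>x\<in>carr V. f x + g x),
       vsmult = (\<lambda>c f. \<lambda>x\<in>carr V. c * f x),
       mcone = (\<lambda>p. {F \<in> carrier_mat p p.
                 elements_mat F \<subseteq> dual_space V \<and>
                 completely_positive V (matrix_algebra p) (\<lambda>x. map_mat (\<lambda>f. f x) F)}),
       vunit = e \<rparr>"

definition cuntz_dual_basis ::
  "nat \<Rightarrow> (nat \<Rightarrow> 'a::cstar_algebra) \<Rightarrow>
     ('a \<Rightarrow> complex) \<Rightarrow> (nat \<Rightarrow> 'a \<Rightarrow> complex) \<Rightarrow> (nat \<Rightarrow> 'a \<Rightarrow> complex) \<Rightarrow> bool" where
  "cuntz_dual_basis n S \<delta>0 \<delta> \<delta>s \<longleftrightarrow>
     \<delta>0 \<in> dual_space (cuntz_system n S) \<and>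
     \<delta>0 1 = 1 \<and> (\<forall>j\<in>{1..n}. \<delta>0 (S j) = 0 \<and> \<delta>0 (adj (S j)) = 0) \<and>
     (\<forall>i\<in>{1..n}.
        \<delta> i \<in> dual_space (cuntz_system n S) \<and> \<delta> i 1 = 0 \<and>
        (\<forall>j\<in>{1..n}. \<delta> i (S j) = (if i = j then 1 else 0) \<and> \<delta> i (adj (S j)) = 0)) \<and>
     (\<forall>i\<in>{1..n}.
        \<delta>s i \<in> dual_space (cuntz_system n S) \<and> \<delta>s i 1 = 0 \<and>
        (\<forall>j\<in>{1..n}. \<delta>s i (adj (S j)) = (if i = j then 1 else 0) \<and> \<delta>s i (S j) = 0))"

definition theta_map ::
  "nat \<Rightarrow> (nat \<Rightarrow> 'a::cstar_algebra) \<Rightarrow>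
     ('a \<Rightarrow> complex) \<Rightarrow> (nat \<Rightarrow> 'a \<Rightarrow> complex) \<Rightarrow> (nat \<Rightarrow> 'a \<Rightarrow> complex) \<Rightarrow>
     (('a \<Rightarrow> complex) \<Rightarrow> complex mat) \<Rightarrow> bool" where
  "theta_map n S \<delta>0 \<delta> \<delta>s \<theta> \<longleftrightarrow>
     linear_map (dual_system (cuntz_system n S) \<delta>0) (E' n) \<theta> \<and>
     \<theta> \<delta>0 = 1\<^sub>m (n + 1) \<and>
     (\<forall>i\<in>{1..n}. \<theta> (\<delta> i) = matrix_unit (n + 1) 0 i \<and> \<theta> (\<delta>s i) = matrix_unit (n + 1) i 0)"

end

(*
  Suppose theta(F) is positive, where F is a p x p matrix of functionals. Put A = F(1) + eps and choose B i
  with A (B i) = F(adj (S i)). Positivity of theta(F) makes Delta = A - (sum over i of adj (B i) A (B i))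
  strictly positive. Hence Popescu's Poisson kernel, which maps xi to the sum over words u of
  S_u z (Delta^(1/2) B_u xi), truncated to words of length at most M, makes sense inside the Cuntz algebra,
  with z an isometry whose range is orthogonal to the ranges of S_u z for short words u. Compressing 1, S i
  and adj (S i) by it gives scalars that converge to the entries of A, F(S i) and F(adj (S i)), while
  compressing a positive matrix adj Y * Y gives a nonnegative number. Letting eps tend to 0, F is completely
  positive. Neither representations of the Cuntz algebra nor its uniqueness theorem are needed.
  Conversely, theta(F) is the value of F at the positive matrix with first row (1, S 1, ..., S n), first
  column the adjoint of that, and 1 on the diagonal.
*)
theory Submission
  imports Defs "Jordan_Normal_Form.Determinant"
begin

section \<open>Elementary C*-algebra\<close>

text \<open>Matrix cones of a C*-algebra appear here only as sets of products
  \<open>adj Y * Y\<close>, with no spectral theory behind them. Even the nonnegativity of a scalar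
  of the form \<open>adj y * y\<close>, and the orthogonality of the ranges of the isometries, must
  come from norm estimates. Compression suits this description of the cones: \<open>Y\<close> has
  entries in the Cuntz algebra and not in the operator system, but only the entries of
  \<open>adj Y * Y\<close> have to compress to scalars. A Poisson kernel normally uses vectors of
  Fock space that all words move to orthogonal positions. Inside the algebra,
  \<open>S_1^K S_2\<close> does this for words of length at most \<open>K\<close>, hence the
  truncation. The price is that 1 compresses to a partial sum of a series for \<open>A\<close>; the
  strict gap eps, besides making \<open>A\<close> invertible, makes the remainder decay
  geometrically. The perturbation by eps is available inside the dual because
  \<open>\<delta>0\<close> corresponds to the identity matrix.\<close>

lemma scaleC_zero_left [simp]: "0 *\<^sub>C x = (0::'a::cstar_algebra)"
  using scaleC_add_left[of 0 0 x] by simp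

lemma scaleC_zero_right [simp]: "c *\<^sub>C 0 = (0::'a::cstar_algebra)"
  using scaleC_add_right[of c 0 0] by simp

lemma scaleC_one [simp]: "1 *\<^sub>C x = (x::'a::cstar_algebra)"
  using scaleR_scaleC[of 1 x] by simp

lemma scaleC_minus_left: "(- c) *\<^sub>C x = - (c *\<^sub>C (x::'a::cstar_algebra))"
  using scaleC_add_left[of c "- c" x] by (simp add: eq_neg_iff_add_eq_0 add.commute)

lemma scaleC_minus_right: "c *\<^sub>C (- x) = - (c *\<^sub>C (x::'a::cstar_algebra))"
  using scaleC_add_right[of c x "- x"] by (simp add: eq_neg_iff_add_eq_0 add.commute)

lemma scaleC_diff_right: "c *\<^sub>C (x - y) = c *\<^sub>C x - c *\<^sub>C (y::'a::cstar_algebra)"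
  using scaleC_add_right[of c x "- y"] by (simp add: scaleC_minus_right)

lemma scaleC_scaleR: "c *\<^sub>C (r *\<^sub>R x) = r *\<^sub>R (c *\<^sub>C (x::'a::cstar_algebra))"
  by (simp add: scaleR_scaleC scaleC_scaleC mult.commute)

lemma scaleC_sum_left: "(\<Sum>i\<in>I. c i) *\<^sub>C x = (\<Sum>i\<in>I. c i *\<^sub>C (x :: 'a::cstar_algebra))"
  by (induction I rule: infinite_finite_induct) (auto simp: scaleC_add_left)

lemma scaleC_one_cancel [simp]: "c *\<^sub>C (1::'a::cstar_algebra) = d *\<^sub>C 1 \<longleftrightarrow> c = d"
proof
  assume "c *\<^sub>C (1::'a) = d *\<^sub>C 1"
  then have "(c + - d) *\<^sub>C (1::'a) = 0"
    by (simp only: scaleC_add_left scaleC_minus_left) simp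
  then have "norm ((c - d) *\<^sub>C (1::'a)) = 0" by simp
  then show "c = d" by (simp add: norm_scaleC)
qed simp

lemma adj_zero [simp]: "adj (0::'a::cstar_algebra) = 0"
  using adj_add[of "0::'a" 0] by simp

lemma adj_minus: "adj (- x) = - adj (x::'a::cstar_algebra)"
  using adj_add[of x "- x"] by (simp add: eq_neg_iff_add_eq_0 add.commute)

lemma adj_diff: "adj (x - y) = adj x - adj (y::'a::cstar_algebra)"
  using adj_add[of x "- y"] by (simp add: adj_minus)

lemma adj_one [simp]: "adj (1::'a::cstar_algebra) = 1"
proof -
  have "adj (adj 1 * 1) = adj 1 * adj (adj (1::'a))" by (rule adj_mult)
  then show ?thesis by (simp add: adj_adj)
qed

lemma adj_sum: "adj (\<Sum>i\<in>I. f i) = (\<Sum>i\<in>I. adj (f i :: 'a::cstar_algebra))"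
  by (induction I rule: infinite_finite_induct) (auto simp: adj_add)

lemma adj_scaleR: "adj (r *\<^sub>R x) = r *\<^sub>R adj (x::'a::cstar_algebra)"
  by (simp add: scaleR_scaleC adj_scaleC)

lemma norm_adj [simp]: "norm (adj x) = norm (x::'a::cstar_algebra)"
proof -
  have le: "norm y \<le> norm (adj y)" for y :: 'a
  proof (cases "y = 0")
    case False
    have "norm y * norm y \<le> norm (adj y) * norm y"
      using norm_mult_ineq[of "adj y" y] by (simp add: norm_adj_mult power2_eq_square)
    then show ?thesis using False by simp
  qed simp
  show ?thesis using le[of x] le[of "adj x"] by (simp add: adj_adj)
qed

lemma adj_mult_eq_0_iff: "adj x * x = 0 \<longleftrightarrow> x = (0::'a::cstar_algebra)"
  using norm_adj_mult[of x] by auto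

lemma norm_isometry: "adj x * x = 1 \<Longrightarrow> norm (x::'a::cstar_algebra) = 1"
  using norm_adj_mult[of x] by (simp add: power2_eq_1_iff) (smt (verit) norm_ge_zero)

section \<open>Norm estimates in place of positivity and functional calculus\<close>

lemma norm_projection_le_1:
  assumes "adj e = e" "e * e = (e::'a::cstar_algebra)"
  shows "norm e \<le> 1"
proof -
  have "(norm e)\<^sup>2 = norm e" using norm_adj_mult[of e] assms by simp
  then show ?thesis by (auto simp: power2_eq_square)
qed

text \<open>\<open>1 - s e\<close> is a convex combination of 1 and the projection
  \<open>1 - e\<close>.\<close>

lemma norm_one_minus_projection:
  assumes "adj e = e" "e * e = (e::'a::cstar_algebra)" "0 \<le> s" "s \<le> 1"
  shows "norm (1 - s *\<^sub>R e) \<le> 1"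
proof -
  have "norm (1 - e) \<le> 1"
    by (rule norm_projection_le_1) (use assms in \<open>auto simp: adj_diff algebra_simps\<close>)
  then have le: "s * norm (1 - e) \<le> s" using assms(3) by (simp add: mult_left_le)
  have "1 - s *\<^sub>R e = (1 - s) *\<^sub>R 1 + s *\<^sub>R (1 - e)"
    by (simp add: algebra_simps)
  then have "norm (1 - s *\<^sub>R e) \<le> (1 - s) + s * norm (1 - e)"
    using norm_triangle_ineq[of "(1 - s) *\<^sub>R 1" "s *\<^sub>R (1 - e)"] assms(3,4) by simp
  then show ?thesis using le by linarith
qed

text \<open>With \<open>u = 1 + \<i> t a - t\<^sup>2 a\<^sup>2 / 2\<close> and \<open>t\<^sup>2 = 2 s\<close>, the mean of \<open>u\<close> and \<open>adj u\<close> is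
  \<open>1 - s a\<^sup>2\<close>, while \<open>adj u * u = 1 + s\<^sup>2 a\<^sup>4\<close>.\<close>

lemma norm_one_minus_square:
  fixes a :: "'a::cstar_algebra"
  assumes a: "adj a = a" and s: "0 \<le> s"
  shows "norm (1 - s *\<^sub>R (a * a)) \<le> 1 + s\<^sup>2 * norm a ^ 4"
proof -
  define t where "t = sqrt (2 * s)"
  define q where "q = s *\<^sub>R (a * a)"
  define h where "h = 1 - q"
  define k where "k = t *\<^sub>R (\<i> *\<^sub>C a)"
  have "k * k = - ((t * t) *\<^sub>R (a * a))"
    by (simp add: k_def scaleC_scaleR mult_scaleC_left mult_scaleC_right scaleC_scaleC scaleC_minus_left)
  also have "t * t = 2 * s" using s by (simp add: t_def)
  also have "(2 * s) *\<^sub>R (a * a) = q + q" by (simp only: q_def mult_2 scaleR_add_left)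
  finally have kk: "k * k = - (q + q)" .
  have ak: "adj k = - k"
    by (simp add: k_def adj_scaleC adj_scaleR a scaleC_minus_left)
  have ah: "adj h = h"
    by (simp add: h_def q_def adj_diff adj_scaleR adj_mult a)
  have hk: "h * k = k * h"
    by (simp add: h_def q_def k_def scaleC_diff_right scaleC_scaleR scaleR_diff_right mult_scaleC_left mult_scaleC_right left_diff_distrib
        right_diff_distrib mult.assoc)
  have "adj (h + k) * (h + k) = h * h - k * k"
    by (simp add: adj_add ak ah hk left_diff_distrib distrib_left)
  also have "\<dots> = 1 + q * q"
    by (simp add: h_def kk algebra_simps)
  finally have "(norm (h + k))\<^sup>2 = norm (1 + q * q)"
    by (metis norm_adj_mult)
  also have "\<dots> \<le> 1 + norm q * norm q"
    using norm_triangle_ineq[of 1 "q * q"] norm_mult_ineq[of q q] by simp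
  also have "norm q * norm q \<le> (s * (norm a * norm a)) * (s * (norm a * norm a))"
    using s norm_mult_ineq[of a a] by (intro mult_mono) (auto simp: q_def mult_left_mono)
  finally have "(norm (h + k))\<^sup>2 \<le> 1 + s\<^sup>2 * norm a ^ 4"
    by (simp add: power2_eq_square power4_eq_xxxx mult_ac)
  also have "\<dots> \<le> (1 + s\<^sup>2 * norm a ^ 4)\<^sup>2"
    by (rule self_le_power) auto
  finally have n1: "norm (h + k) \<le> 1 + s\<^sup>2 * norm a ^ 4"
    by (rule power2_le_imp_le) simp
  have "norm (h - k) = norm (adj (h + k))" by (simp add: adj_add ah ak)
  then have n2: "norm (h - k) \<le> 1 + s\<^sup>2 * norm a ^ 4" using n1 by simp
  have "2 *\<^sub>R h = (h + k) + (h - k)" by (simp add: scaleR_2)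
  then have "2 * norm h \<le> norm (h + k) + norm (h - k)"
    using norm_triangle_ineq[of "h + k" "h - k"] by (metis norm_scaleR abs_numeral)
  then show ?thesis using n1 n2 unfolding h_def q_def by linarith
qed

text \<open>If \<open>adj y * y = -1\<close>, then \<open>e = - y * adj y\<close> is a projection,
  and with \<open>a\<close>, \<open>b\<close> the real and (up to sign) imaginary parts of
  \<open>y\<close> one gets \<open>e + 2 a^2 + 2 b^2 = -1\<close>. Subtracting \<open>s\<close>
  times each summand from 1 gives three elements of norm at most \<open>1 + O(s^2)\<close>, yet
  their sum is \<open>3 + s\<close>. This is impossible for small \<open>s\<close>.\<close>

lemma adj_mult_ne_minus_one: "adj y * y \<noteq> (- 1 :: 'a::cstar_algebra)"
proof
  assume y: "adj y * y = -1"
  define e where "e = - (y * adj y)"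
  define a where "a = (1/2) *\<^sub>R (y + adj y)"
  define b where "b = (1/2) *\<^sub>R (\<i> *\<^sub>C (y - adj y))"
  have ae: "adj e = e" by (simp add: e_def adj_minus adj_mult adj_adj)
  have "e * e = y * (adj y * y) * adj y" by (simp add: e_def mult.assoc)
  then have ee: "e * e = e" by (simp add: y e_def)
  have aa: "adj a = a" by (simp add: a_def adj_scaleR adj_add adj_adj add.commute)
  have ab: "adj b = b"
    by (simp add: b_def adj_scaleR adj_scaleC adj_diff adj_adj scaleC_minus_left scaleC_diff_right)
  have bb: "b * b = - (1/4) *\<^sub>R ((y - adj y) * (y - adj y))"
    by (simp add: b_def scaleC_scaleR mult_scaleC_left mult_scaleC_right scaleC_scaleC scaleC_minus_left)
  have aabb: "2 *\<^sub>R (a * a) + 2 *\<^sub>R (b * b) = - 1 - e"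
  proof -
    have "(y + adj y) * (y + adj y) - (y - adj y) * (y - adj y)
        = (adj y * y + y * adj y) + (adj y * y + y * adj y)"
      by (simp add: distrib_left distrib_right left_diff_distrib right_diff_distrib)
    also have "\<dots> = 2 *\<^sub>R (- 1 - e)" by (simp only: scaleR_2 y e_def, simp)
    finally have "(1/2) *\<^sub>R ((y + adj y) * (y + adj y) - (y - adj y) * (y - adj y)) = - 1 - e"
      by simp
    moreover have "2 *\<^sub>R (a * a) = (1/2) *\<^sub>R ((y + adj y) * (y + adj y))" by (simp add: a_def)
    moreover have "2 *\<^sub>R (b * b) = - (1/2) *\<^sub>R ((y - adj y) * (y - adj y))" by (simp add: bb)
    ultimately show ?thesis by (simp only: scaleR_diff_right, simp)
  qed
  \<comment> \<open>The second-order errors with parameter \<open>2 * s\<close> add up to at most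
    \<open>s^2 C\<close>. With \<open>s C = 1/2\<close> this is at most \<open>s / 2\<close>, less
    than the excess \<open>s\<close>; the summand 1 keeps \<open>C\<close> positive and
    \<open>s\<close> below 1.\<close>
  define C where "C = 4 * norm a ^ 4 + 4 * norm b ^ 4 + 1"
  have C: "C \<ge> 1" by (simp add: C_def)
  define s where "s = 1 / (2 * C)"
  have s: "0 < s" "s \<le> 1" using C by (auto simp: s_def divide_simps)
  have "(1 - s *\<^sub>R e) + (1 - (2 * s) *\<^sub>R (a * a)) + (1 - (2 * s) *\<^sub>R (b * b))
      = (1 + 1 + 1) - s *\<^sub>R (e + (2 *\<^sub>R (a * a) + 2 *\<^sub>R (b * b)))"
    by (simp only: scaleR_add_right scaleR_scaleR mult.commute[of s 2], simp)
  also have "\<dots> = (1 + 1 + 1 + s) *\<^sub>R 1"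
    by (simp only: aabb scaleR_add_left scaleR_one, simp)
  finally have "3 + s = norm ((1 - s *\<^sub>R e) + (1 - (2 * s) *\<^sub>R (a * a)) + (1 - (2 * s) *\<^sub>R (b * b)))"
    using s by simp
  also have "\<dots> \<le> norm (1 - s *\<^sub>R e) + norm (1 - (2 * s) *\<^sub>R (a * a)) + norm (1 - (2 * s) *\<^sub>R (b * b))"
    by (meson add_mono norm_triangle_ineq order_refl order_trans)
  also have "\<dots> \<le> 1 + (1 + (2 * s)\<^sup>2 * norm a ^ 4) + (1 + (2 * s)\<^sup>2 * norm b ^ 4)"
    by (intro add_mono norm_one_minus_projection norm_one_minus_square) (use s ae ee aa ab in auto)
  also have "\<dots> \<le> 3 + s * (s * C)"
    by (simp add: C_def power2_eq_square algebra_simps)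
  also have "s * C = 1 / 2" using C by (simp add: s_def)
  finally show False using s by simp
qed

text \<open>Self-adjointness makes \<open>c\<close> real, and a negative \<open>c\<close> can be
  rescaled to -1. Positivity of squares enters the proof only through such scalars.\<close>

lemma adj_mult_eq_scalar_nonneg:
  assumes "adj y * y = c *\<^sub>C (1::'a::cstar_algebra)"
  shows "0 \<le> c"
proof -
  have "adj (adj y * y) = adj y * y" by (simp add: adj_mult adj_adj)
  then have "cnj c = c" using assms by (simp add: adj_scaleC)
  then have im: "Im c = 0" by (metis Reals_cnj_iff complex_is_Real_iff)
  have "\<not> Re c < 0"
  proof
    assume neg: "Re c < 0"
    define y' where "y' = (1 / sqrt (- Re c)) *\<^sub>R y"
    have "adj y' * y' = (1 / (- Re c)) *\<^sub>R (adj y * y)"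
      using neg by (simp add: y'_def adj_scaleR)
    also have "adj y * y = Re c *\<^sub>R 1"
      unfolding assms scaleR_scaleC by (simp add: im complex_eq_iff)
    also have "(1 / (- Re c)) *\<^sub>R (Re c *\<^sub>R 1) = (- 1 :: 'a)"
      using neg by simp
    finally show False using adj_mult_ne_minus_one[of y'] by simp
  qed
  then show ?thesis using im by (simp add: less_eq_complex_def)
qed

text \<open>Amplification: \<open>2 - 6 k\<^sup>2\<close> is \<open>1 - k\<^sup>4\<close> plus the mean of \<open>(1 + \<i> k)\<^sup>4\<close> and
  \<open>(1 - \<i> k)\<^sup>4\<close>, and \<open>4 + 6 k\<close> is the sum of \<open>3 (1 + k)\<^sup>2\<close> and \<open>1 - 3 k\<^sup>2\<close>.\<close>

lemma norm_one_plus_minus_amplify: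
  fixes k :: "'a::cstar_algebra"
  assumes k: "adj k = k" and p: "norm (1 + k) \<le> 1" and m: "norm (1 - k) \<le> 1"
  shows "norm (1 + (3/2) *\<^sub>R k) \<le> 1"
proof -
  have mult: "norm (x * y) \<le> 1" if "norm x \<le> 1" "norm y \<le> 1" for x y :: 'a
    using norm_mult_ineq[of x y] mult_le_one[OF that(1) norm_ge_zero that(2)] by linarith
  have mean: "norm z \<le> 1" if "norm x \<le> 1" "norm y \<le> 1" "x + y = z + z" for x y z :: 'a
  proof -
    have "norm (x + y) = 2 * norm z" unfolding that(3) scaleR_2[symmetric] by simp
    then show ?thesis using that(1,2) norm_triangle_ineq[of x y] by linarith
  qed
  define j where "j = \<i> *\<^sub>C k"
  define q where "q = k * k"
  have jj: "j * j = - q"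
    by (simp add: j_def q_def mult_scaleC_left mult_scaleC_right scaleC_scaleC scaleC_minus_left)
  have aj: "adj j = - j" by (simp add: j_def adj_scaleC k scaleC_minus_left)
  have q: "norm (1 + q) \<le> 1"
  proof (rule mean)
    show "norm ((1 + k) * (1 + k)) \<le> 1" "norm ((1 - k) * (1 - k)) \<le> 1"
      by (intro mult p m)+
  qed (simp add: q_def distrib_left distrib_right left_diff_distrib right_diff_distrib)
  have "adj (1 + j) * (1 + j) = 1 + q" by (simp add: adj_add aj jj algebra_simps)
  then have "(norm (1 + j))\<^sup>2 \<le> 1" using q norm_adj_mult[of "1 + j"] by simp
  then have pj: "norm (1 + j) \<le> 1" by (simp add: abs_square_le_1)
  have "norm (1 - j) = norm (adj (1 + j))" by (simp add: adj_add aj)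
  then have mj: "norm (1 - j) \<le> 1" using pj by simp
  have "(1 - k) * (1 + k) = 1 - q" by (simp add: q_def algebra_simps)
  then have "norm (1 - q) \<le> 1" using mult[OF m p] by simp
  then have q2: "norm (1 - q * q) \<le> 1"
    using mult[OF q, of "1 - q"] by (simp add: distrib_right right_diff_distrib)
  define P where "P = (1 - q) + (j + j)"
  define M where "M = (1 - q) - (j + j)"
  have "P = (1 + j) * (1 + j)" "M = (1 - j) * (1 - j)"
    by (simp_all add: P_def M_def distrib_left distrib_right left_diff_distrib right_diff_distrib jj)
  then have "norm P \<le> 1" "norm M \<le> 1" by (auto intro!: mult pj mj)
  then have "norm (P * P) \<le> 1" "norm (M * M) \<le> 1" by (auto intro!: mult)
  moreover have "P * P + M * M = ((1 - q) * (1 - q) - (q + q + q + q)) + ((1 - q) * (1 - q) - (q + q + q + q))"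
  proof -
    have *: "(a + b) * (a + b) + (a - b) * (a - b) = (a * a + b * b) + (a * a + b * b)" for a b :: 'a
      by (simp add: distrib_left distrib_right left_diff_distrib right_diff_distrib)
    have "(j + j) * (j + j) = - (q + q + q + q)"
      by (simp add: distrib_left distrib_right jj)
    then show ?thesis unfolding P_def M_def * by simp
  qed
  ultimately have "norm ((1 - q) * (1 - q) - (q + q + q + q)) \<le> 1"
    by (rule mean)
  then have q3: "norm (1 - (q + q + q)) \<le> 1"
    by (rule mean[OF q2]) (simp add: left_diff_distrib right_diff_distrib)
  define Q where "Q = (1 + k) * (1 + k)"
  have Q: "norm Q \<le> 1" unfolding Q_def by (intro mult p)
  have three: "3 *\<^sub>R x = x + x + x" for x :: 'a
    using scaleR_left_distrib[of 2 1 x] by (simp add: scaleR_2)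
  have "4 *\<^sub>R (1 + (3/2) *\<^sub>R k) = 2 *\<^sub>R (2 *\<^sub>R 1 + 3 *\<^sub>R k)"
    by (simp add: scaleR_add_right)
  also have "\<dots> = Q + Q + Q + (1 - (q + q + q))"
    by (simp only: three scaleR_2, simp add: Q_def q_def distrib_left distrib_right)
  finally have "4 *\<^sub>R (1 + (3/2) *\<^sub>R k) = Q + Q + Q + (1 - (q + q + q))" .
  then have "4 * norm (1 + (3/2) *\<^sub>R k) = norm (Q + Q + Q + (1 - (q + q + q)))"
    using norm_scaleR[of 4 "1 + (3/2) *\<^sub>R k"] by simp
  also have "\<dots> \<le> norm Q + norm Q + norm Q + norm (1 - (q + q + q))"
    by (meson add_mono norm_triangle_ineq order_refl order_trans)
  finally show ?thesis using Q q3 by linarith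
qed

text \<open>Iterated amplification keeps both bounds for \<open>(3/2)^N k\<close>, so
  \<open>(3/2)^N * norm k\<close> stays below 2. This replaces the fact that the positive cone meets
  its negative only in 0.\<close>

lemma selfadjoint_eq_0:
  fixes k :: "'a::cstar_algebra"
  assumes k: "adj k = k" and p: "norm (1 + k) \<le> 1" and m: "norm (1 - k) \<le> 1"
  shows "k = 0"
proof (rule ccontr)
  assume "k \<noteq> 0"
  have *: "norm (1 + (3/2) ^ N *\<^sub>R k) \<le> 1 \<and> norm (1 - (3/2) ^ N *\<^sub>R k) \<le> 1" for N :: nat
  proof (induction N)
    case (Suc N)
    have "norm (1 + (3/2) *\<^sub>R ((3/2) ^ N *\<^sub>R k)) \<le> 1"
      by (rule norm_one_plus_minus_amplify) (use Suc in \<open>auto simp: adj_scaleR k\<close>)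
    moreover have "norm (1 + (3/2) *\<^sub>R (- ((3/2) ^ N *\<^sub>R k))) \<le> 1"
      by (rule norm_one_plus_minus_amplify) (use Suc in \<open>auto simp: adj_scaleR adj_minus k\<close>)
    ultimately show ?case by simp
  qed (use p m in auto)
  obtain N :: nat where N: "2 / norm k < (3/2) ^ N"
    using real_arch_pow[of "3/2" "2 / norm k"] by auto
  have "(3/2) ^ N * norm k = norm ((1 + (3/2) ^ N *\<^sub>R k) - 1)" by simp
  also have "\<dots> \<le> 2" using norm_triangle_ineq4[of "1 + (3/2) ^ N *\<^sub>R k" 1] * by (smt (verit) norm_one)
  finally show False using N \<open>k \<noteq> 0\<close> by (simp add: field_simps)
qed

section \<open>Cuntz isometries\<close>

locale cuntz_family =
  fixes n :: nat and S :: "nat \<Rightarrow> 'a::cstar_algebra"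
  assumes two_le_n: "2 \<le> n" and isometries: "cuntz_isometries n S"
begin

lemma isometry: "i \<in> {1..n} \<Longrightarrow> adj (S i) * S i = 1"
  using isometries by (simp add: cuntz_isometries_def)

lemma range_projections_sum: "(\<Sum>i=1..n. S i * adj (S i)) = 1"
  using isometries by (simp add: cuntz_isometries_def)

text \<open>The elements \<open>x l = S\<^sub>j\<^sup>* S\<^sub>l S\<^sub>l\<^sup>* S\<^sub>j\<close> with \<open>l \<noteq> j\<close> sum to zero, and each satisfies
  \<open>norm (1 - s x l) \<le> 1\<close> for \<open>0 \<le> s \<le> 1\<close>. Hence \<open>norm (1 \<plusminus> x i / n) \<le> 1\<close>.\<close>

lemma ranges_orthogonal:
  assumes i: "i \<in> {1..n}" and j: "j \<in> {1..n}" and ij: "i \<noteq> j"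
  shows "adj (S i) * S j = 0"
proof -
  define P where "P = (\<lambda>l. S l * adj (S l))"
  define x where "x = (\<lambda>l. adj (S j) * P l * S j)"
  define R where "R = {1..n} - {i, j}"
  have aP: "adj (P l) = P l" for l by (simp add: P_def adj_mult adj_adj)
  have PP: "P l * P l = P l" if "l \<in> {1..n}" for l
  proof -
    have "P l * P l = S l * (adj (S l) * S l) * adj (S l)" by (simp add: P_def mult.assoc)
    then show ?thesis by (simp add: isometry[OF that] P_def)
  qed
  have ax: "adj (x l) = x l" for l by (simp add: x_def adj_mult adj_adj aP mult.assoc)
  have nx: "norm (1 - s *\<^sub>R x l) \<le> 1" if l: "l \<in> {1..n}" and s: "0 \<le> s" "s \<le> 1" for s l
  proof -
    have "1 - s *\<^sub>R x l = adj (S j) * (1 - s *\<^sub>R P l) * S j"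
      by (simp add: x_def right_diff_distrib left_diff_distrib isometry[OF j])
    then have "norm (1 - s *\<^sub>R x l) \<le> norm (adj (S j)) * norm (1 - s *\<^sub>R P l) * norm (S j)"
      by (simp del: norm_adj) (meson mult_right_mono norm_ge_zero norm_mult_ineq order_trans)
    then show ?thesis
      using norm_one_minus_projection[OF aP PP[OF l] s] by (simp add: norm_isometry isometry[OF j])
  qed
  have xj: "x j = 1"
  proof -
    have "x j = (adj (S j) * S j) * (adj (S j) * S j)" by (simp add: x_def P_def mult.assoc)
    then show ?thesis by (simp add: isometry[OF j])
  qed
  have R: "finite R" "i \<notin> R" "j \<notin> R" "{1..n} = insert i (insert j R)"
    using i j by (auto simp: R_def)
  have "(\<Sum>l=1..n. x l) = adj (S j) * (\<Sum>l=1..n. P l) * S j"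
    by (simp add: x_def sum_distrib_left sum_distrib_right)
  also have "\<dots> = 1" using range_projections_sum by (simp add: P_def isometry[OF j])
  finally have xi: "x i = - (\<Sum>l\<in>R. x l)"
    unfolding R(4) using R(1-3) ij xj by (simp add: eq_neg_iff_add_eq_0)
  have n: "real n = real (card R) + 2"
    using arg_cong[OF R(4), of card] R(1-3) ij by simp
  have npos: "0 < real n" "1 / real n \<le> 1" using two_le_n by auto
  define k where "k = (1 / real n) *\<^sub>R x i"
  have "k = 0"
  proof (rule selfadjoint_eq_0)
    show "adj k = k" by (simp add: k_def adj_scaleR ax)
    show "norm (1 - k) \<le> 1" unfolding k_def by (rule nx[OF i]) (use npos in auto)
    \<comment> \<open>Since \<open>n = card R + 2\<close>, each \<open>l\<close> in \<open>R\<close>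
      receives one unit and becomes \<open>1 - x l\<close>, of norm at most 1, while two units
      remain. The triangle inequality then gives exactly \<open>n\<close>.\<close>
    have "real n *\<^sub>R (1 + k) = real n *\<^sub>R 1 - (\<Sum>l\<in>R. x l)"
      using npos by (simp add: k_def scaleR_add_right scaleR_diff_right xi)
    also have "\<dots> = (\<Sum>l\<in>R. 1 - 1 *\<^sub>R x l) + 2 *\<^sub>R 1"
      unfolding n by (simp add: sum_subtractf scaleR_add_left scaleR_conv_of_real)
    finally have "norm (real n *\<^sub>R (1 + k)) \<le> norm (\<Sum>l\<in>R. 1 - 1 *\<^sub>R x l) + norm (2 *\<^sub>R (1::'a))"
      by (simp only: norm_triangle_ineq)
    also have "norm (\<Sum>l\<in>R. 1 - 1 *\<^sub>R x l) \<le> real (card R) * 1"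
      by (intro sum_norm_bound nx) (auto simp: R_def)
    finally have "real n * norm (1 + k) \<le> real n" using n by simp
    then show "norm (1 + k) \<le> 1" using npos by simp
  qed
  then have "x i = 0" using npos by (simp add: k_def)
  then have "adj (adj (S i) * S j) * (adj (S i) * S j) = 0"
    by (simp add: x_def P_def adj_mult adj_adj mult.assoc)
  then show ?thesis by (simp add: adj_mult_eq_0_iff)
qed

lemma adj_mult_isometries:
  "i \<in> {1..n} \<Longrightarrow> j \<in> {1..n} \<Longrightarrow> adj (S i) * S j = (if i = j then 1 else 0)"
  by (simp add: isometry ranges_orthogonal)

section \<open>Isometries with orthogonal ranges, and words\<close>

lemma one_two_mem: "1 \<in> {1..n}" "2 \<in> {1..n}"
  using two_le_n by auto

lemma adj_power_mult_power: "adj (S 1 ^ k) * S 1 ^ (k + m) = S 1 ^ m"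
proof (induction k)
  case (Suc k)
  have "adj (S 1 ^ Suc k) * S 1 ^ (Suc k + m) = adj (S 1 ^ k) * (adj (S 1) * S 1) * S 1 ^ (k + m)"
    by (simp add: adj_mult mult.assoc)
  then show ?case using Suc isometry[OF one_two_mem(1)] by simp
qed simp

lemma adj_two_mult_power: "0 < m \<Longrightarrow> adj (S 2) * S 1 ^ m = 0"
  by (cases m) (simp_all add: mult.assoc[symmetric] ranges_orthogonal[OF one_two_mem(2,1), simplified])

text \<open>Two generators already yield an infinite sequence of isometries with pairwise orthogonal
  ranges. An unlimited supply is wanted because the rank \<open>N\<close> of the defect and the
  matrix size \<open>q\<close> are not bounded by \<open>n\<close>.\<close>

definition tag :: "nat \<Rightarrow> 'a" where "tag c = S 1 ^ c * S 2"

lemma tag_orthonormal: "adj (tag c) * tag d = (if c = d then 1 else 0)"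
proof -
  have less: "adj (tag c) * tag d = 0" if "c < d" for c d
  proof -
    have "adj (tag c) * tag d = adj (S 2) * (adj (S 1 ^ c) * S 1 ^ (c + (d - c))) * S 2"
      using that by (simp add: tag_def adj_mult mult.assoc)
    then show ?thesis using that by (simp only: adj_power_mult_power adj_two_mult_power zero_less_diff) simp
  qed
  have "adj (tag c) * tag c = adj (S 2) * (adj (S 1 ^ c) * S 1 ^ (c + 0)) * S 2" for c
    by (simp add: tag_def adj_mult mult.assoc)
  then have eq: "adj (tag c) * tag c = 1" for c
    unfolding adj_power_mult_power by (simp add: isometry[OF one_two_mem(2)])
  have "adj (tag c) * tag d = adj (adj (tag d) * tag c)" by (simp add: adj_mult adj_adj)
  then show ?thesis using less[of c d] less[of d c] eq by (cases c d rule: linorder_cases) auto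
qed

definition word :: "nat list \<Rightarrow> 'a" where "word u = prod_list (map S u)"

lemma word_simps [simp]: "word [] = 1" "word (i # u) = S i * word u" "word (u @ w) = word u * word w"
  by (simp_all add: word_def)

text \<open>Letters cancel one at a time: \<open>adj (S 1)\<close> removes a letter 1 and
  annihilates any other, so only powers of \<open>S 1\<close> survive.\<close>

lemma adj_power_mult_word:
  assumes "set u \<subseteq> {1..n}" "length u \<le> K"
  shows "adj (S 1 ^ K) * word u = 0 \<or> adj (S 1 ^ K) * word u = adj (S 1 ^ (K - length u))"
  using assms
proof (induction u arbitrary: K)
  case (Cons i u)
  then obtain L where K: "K = Suc L" by (cases K) auto
  have "adj (S 1 ^ K) * word (i # u) = adj (S 1 ^ L) * (adj (S 1) * S i) * word u"
    by (simp add: K adj_mult mult.assoc)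
  then show ?case
    using Cons adj_mult_isometries[OF one_two_mem(1), of i] by (auto simp: K)
qed simp

text \<open>Up to words of length \<open>K\<close>, the \<open>wander K c\<close> behave like orthonormal wandering vectors.\<close>

definition wander :: "nat \<Rightarrow> nat \<Rightarrow> 'a" where "wander K c = tag K * tag c"

lemma wander_orthonormal: "adj (wander K c) * wander K d = (if c = d then 1 else 0)"
proof -
  have "adj (wander K c) * wander K d = adj (tag c) * (adj (tag K) * tag K) * tag d"
    by (simp add: wander_def adj_mult mult.assoc)
  then show ?thesis by (simp add: tag_orthonormal)
qed

text \<open>A word other than a power of \<open>S 1\<close> dies against
  \<open>adj (S 1 ^ K)\<close>. A power survives as \<open>S 1 ^ length u\<close> between the two
  copies of \<open>S 2\<close>, and there \<open>adj (S 2)\<close> kills it because \<open>u\<close>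
  is nonempty.\<close>

lemma wander_word_wander:
  assumes "set u \<subseteq> {1..n}" "u \<noteq> []" "length u \<le> K"
  shows "adj (wander K c) * word u * wander K d = 0"
proof -
  have *: "adj (wander K c) * word u * wander K d
      = adj (tag c) * (adj (S 2) * (adj (S 1 ^ K) * word u * S 1 ^ K) * S 2) * tag d"
    by (simp add: wander_def tag_def adj_mult mult.assoc)
  consider "adj (S 1 ^ K) * word u = 0" | "adj (S 1 ^ K) * word u = adj (S 1 ^ (K - length u))"
    using adj_power_mult_word[OF assms(1,3)] by blast
  then have "adj (S 2) * (adj (S 1 ^ K) * word u * S 1 ^ K) = 0"
  proof cases
    case 2
    have "adj (S 1 ^ K) * word u * S 1 ^ K
        = adj (S 1 ^ (K - length u)) * S 1 ^ ((K - length u) + length u)"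
      unfolding 2 using assms(3) by simp
    then have "adj (S 1 ^ K) * word u * S 1 ^ K = S 1 ^ length u" by (simp only: adj_power_mult_power)
    then show ?thesis using adj_two_mult_power[of "length u"] assms(2) by (simp del: One_nat_def)
  qed simp
  then show ?thesis by (simp add: *)
qed

text \<open>The column \<open>y\<close> is packed into the single element
  \<open>\<Sum>m. tag m * y m\<close>; orthogonality of the tags removes the cross terms, which
  reduces a sum of squares to one square.\<close>

lemma sum_adj_mult_eq_scalar_nonneg:
  fixes y :: "nat \<Rightarrow> 'a"
  assumes "(\<Sum>m<q. adj (y m) * y m) = c *\<^sub>C 1"
  shows "0 \<le> c"
proof (rule adj_mult_eq_scalar_nonneg)
  have "adj (\<Sum>m<q. tag m * y m) * (\<Sum>m<q. tag m * y m)
      = (\<Sum>m<q. \<Sum>l<q. adj (y m) * (adj (tag m) * tag l) * y l)"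
    by (simp add: adj_sum adj_mult sum_product mult.assoc)
  also have "\<dots> = (\<Sum>m<q. \<Sum>l<q. if m = l then adj (y m) * y l else 0)"
    by (intro sum.cong refl) (simp add: tag_orthonormal)
  also have "\<dots> = (\<Sum>m<q. adj (y m) * y m)" by simp
  finally show "adj (\<Sum>m<q. tag m * y m) * (\<Sum>m<q. tag m * y m) = c *\<^sub>C 1" using assms by simp
qed

section \<open>The Poisson kernel\<close>

context
  fixes N :: nat and D :: "'v \<Rightarrow> nat \<Rightarrow> complex" and B :: "nat \<Rightarrow> 'v \<Rightarrow> 'v"
begin

text \<open>Unfolded, this runs over the words \<open>u\<close> of length less than
  \<open>M\<close>; the maps \<open>B\<close> are applied to \<open>\<xi>\<close> in the order in
  which the letters of \<open>u\<close> are read from the left. The coordinates \<open>D\<close> of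
  a defect vector are carried by \<open>N\<close> orthogonal wandering isometries, so that
  \<open>D\<close> may be any factor of the defect form.\<close>

primrec poisson :: "nat \<Rightarrow> nat \<Rightarrow> 'v \<Rightarrow> 'a" where
  "poisson K 0 \<xi> = 0"
| "poisson K (Suc M) \<xi> = (\<Sum>c<N. D \<xi> c *\<^sub>C wander K c) + (\<Sum>i=1..n. S i * poisson K M (B i \<xi>))"

primrec poisson_gram :: "nat \<Rightarrow> 'v \<Rightarrow> 'v \<Rightarrow> complex" where
  "poisson_gram 0 \<xi> \<eta> = 0"
| "poisson_gram (Suc M) \<xi> \<eta> =
     (\<Sum>c<N. cnj (D \<xi> c) * D \<eta> c) + (\<Sum>i=1..n. poisson_gram M (B i \<xi>) (B i \<eta>))"

text \<open>Each term of the kernel is a word of length at most \<open>M - 1\<close> followed by a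
  wandering isometry. Prefixing \<open>u\<close> therefore stays within length \<open>K\<close>
  exactly when \<open>length u + M \<le> Suc K\<close>.\<close>

lemma wander_word_poisson:
  assumes "set u \<subseteq> {1..n}" "u \<noteq> []" "length u + M \<le> Suc K"
  shows "adj (wander K c) * word u * poisson K M \<xi> = 0"
  using assms
proof (induction M arbitrary: u \<xi>)
  case (Suc M)
  have 1: "adj (wander K c) * word u * (D \<xi> d *\<^sub>C wander K d) = 0" for d
    using wander_word_wander[of u K c d] Suc.prems by (simp add: mult_scaleC_right)
  have 2: "adj (wander K c) * word u * (S i * poisson K M (B i \<xi>)) = 0" if "i \<in> {1..n}" for i
    using Suc.IH[of "u @ [i]" "B i \<xi>"] Suc.prems that by (simp add: mult.assoc)
  show ?case using 2 by (simp add: distrib_left sum_distrib_left 1)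
qed simp

lemma wander_isometry_poisson:
  assumes "i \<in> {1..n}" "M \<le> K"
  shows "adj (wander K c) * (S i * poisson K M \<xi>) = 0"
  using wander_word_poisson[of "[i]" M K c \<xi>] assms by (simp add: mult.assoc)

text \<open>\<open>adj (S i)\<close> strips the first letter, so the depth drops by one and
  \<open>\<eta>\<close> becomes \<open>B i \<eta>\<close>. The empty word has no letter to strip and
  leaves a stray term, which vanishes once it is paired with another kernel.\<close>

lemma adj_isometry_poisson:
  assumes "i \<in> {1..n}"
  shows "adj (S i) * poisson K (Suc M) \<eta>
    = (\<Sum>c<N. D \<eta> c *\<^sub>C (adj (S i) * wander K c)) + poisson K M (B i \<eta>)"
proof -
  have "adj (S i) * (\<Sum>j=1..n. S j * poisson K M (B j \<eta>))
      = (\<Sum>j=1..n. if j = i then poisson K M (B j \<eta>) else 0)"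
    unfolding sum_distrib_left
    by (intro sum.cong refl) (use assms in \<open>simp add: mult.assoc[symmetric] adj_mult_isometries\<close>)
  also have "\<dots> = poisson K M (B i \<eta>)" using assms by simp
  finally show ?thesis by (simp add: distrib_left sum_distrib_left mult_scaleC_right)
qed

lemma wander_poisson:
  assumes "M \<le> K" "c < N"
  shows "adj (wander K c) * poisson K (Suc M) \<xi> = D \<xi> c *\<^sub>C 1"
proof -
  have "adj (wander K c) * (\<Sum>d<N. D \<xi> d *\<^sub>C wander K d) = (\<Sum>d<N. if d = c then D \<xi> d *\<^sub>C 1 else 0)"
    unfolding sum_distrib_left
    by (intro sum.cong refl) (simp add: mult_scaleC_right wander_orthonormal)
  also have "\<dots> = D \<xi> c *\<^sub>C 1" using assms by simp
  finally show ?thesis using assms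
    by (simp add: distrib_left sum_distrib_left wander_isometry_poisson)
qed

lemma poisson_isometry_wander:
  assumes "i \<in> {1..n}" "M \<le> K"
  shows "adj (poisson K M \<xi>) * (adj (S i) * wander K c) = 0"
proof -
  have "adj (poisson K M \<xi>) * (adj (S i) * wander K c) = adj (adj (wander K c) * (S i * poisson K M \<xi>))"
    by (simp add: adj_mult adj_adj mult.assoc)
  then show ?thesis by (simp add: wander_isometry_poisson[OF assms])
qed

text \<open>Distinct words give orthogonal terms, so only words present on both sides contribute.
  Two different depths are allowed because \<open>adj (S i)\<close> shortens one side only.\<close>

lemma adj_poisson_mult_poisson:
  assumes "M \<le> K" "L \<le> K"
  shows "adj (poisson K M \<xi>) * poisson K L \<eta> = poisson_gram (min M L) \<xi> \<eta> *\<^sub>C 1"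
  using assms
proof (induction M arbitrary: L \<xi> \<eta>)
  case (Suc M)
  show ?case
  proof (cases L)
    case (Suc L')
    have "adj (poisson K (Suc M) \<xi>) * poisson K (Suc L') \<eta>
      = (\<Sum>c<N. cnj (D \<xi> c) *\<^sub>C (adj (wander K c) * poisson K (Suc L') \<eta>))
        + (\<Sum>i=1..n. adj (poisson K M (B i \<xi>)) * (adj (S i) * poisson K (Suc L') \<eta>))"
      by (simp only: poisson.simps(2)[of K M] adj_add adj_sum adj_mult adj_scaleC distrib_right
          sum_distrib_right mult_scaleC_left mult.assoc)
    also have "(\<Sum>c<N. cnj (D \<xi> c) *\<^sub>C (adj (wander K c) * poisson K (Suc L') \<eta>))
        = (\<Sum>c<N. cnj (D \<xi> c) * D \<eta> c) *\<^sub>C 1"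
      unfolding scaleC_sum_left
      by (intro sum.cong refl) (use Suc.prems Suc in \<open>simp add: wander_poisson scaleC_scaleC del: poisson.simps\<close>)
    also have "(\<Sum>i=1..n. adj (poisson K M (B i \<xi>)) * (adj (S i) * poisson K (Suc L') \<eta>))
        = (\<Sum>i=1..n. poisson_gram (min M L') (B i \<xi>) (B i \<eta>)) *\<^sub>C 1"
      unfolding scaleC_sum_left
    proof (intro sum.cong refl)
      fix i assume i: "i \<in> {1..n}"
      show "adj (poisson K M (B i \<xi>)) * (adj (S i) * poisson K (Suc L') \<eta>)
          = poisson_gram (min M L') (B i \<xi>) (B i \<eta>) *\<^sub>C 1"
        using Suc.prems Suc i
        by (simp add: adj_isometry_poisson[OF i] distrib_left sum_distrib_left mult_scaleC_right
            poisson_isometry_wander Suc.IH del: poisson.simps)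
    qed
    finally show ?thesis by (simp add: Suc scaleC_add_left del: poisson.simps)
  qed simp
qed simp

text \<open>The right-hand kernel loses one level, hence \<open>M\<close> instead of
  \<open>Suc M\<close>. In the limit this becomes \<open>Q \<xi> (B i \<eta>)\<close>, which is how
  the choice of \<open>B\<close> encodes the value at \<open>adj (S i)\<close>.\<close>

lemma poisson_isometry_poisson:
  assumes "i \<in> {1..n}" "Suc M \<le> K"
  shows "adj (poisson K (Suc M) \<xi>) * adj (S i) * poisson K (Suc M) \<eta> = poisson_gram M \<xi> (B i \<eta>) *\<^sub>C 1"
  using assms adj_poisson_mult_poisson[of "Suc M" K M \<xi> "B i \<eta>"]
  by (simp add: mult.assoc adj_isometry_poisson distrib_left sum_distrib_left mult_scaleC_right
      poisson_isometry_wander del: poisson.simps)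

text \<open>Iterating \<open>step\<close> leaves as remainder the sum of
  \<open>Q (B_u \<xi>) (B_u \<eta>)\<close> over words \<open>u\<close> of length \<open>M\<close>.
  \<open>bound\<close> reduces it to diagonal values, and \<open>contr\<close> shrinks these by the
  factor \<open>r\<close> at every level.\<close>

lemma poisson_gram_tendsto:
  fixes Q :: "'v \<Rightarrow> 'v \<Rightarrow> complex"
  assumes step: "\<And>\<xi> \<eta>. Q \<xi> \<eta> = (\<Sum>c<N. cnj (D \<xi> c) * D \<eta> c) + (\<Sum>i=1..n. Q (B i \<xi>) (B i \<eta>))"
    and bound: "\<And>\<xi> \<eta>. cmod (Q \<xi> \<eta>) \<le> (Re (Q \<xi> \<xi>) + Re (Q \<eta> \<eta>)) / 2"
    and contr: "\<And>\<xi>. (\<Sum>i=1..n. Re (Q (B i \<xi>) (B i \<xi>))) \<le> r * Re (Q \<xi> \<xi>)"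
    and r: "0 \<le> r" "r < 1"
  shows "(\<lambda>M. poisson_gram M \<xi> \<eta>) \<longlonglongrightarrow> Q \<xi> \<eta>"
proof -
  have *: "cmod (Q \<xi> \<eta> - poisson_gram M \<xi> \<eta>) \<le> r ^ M * ((Re (Q \<xi> \<xi>) + Re (Q \<eta> \<eta>)) / 2)" for M \<xi> \<eta>
  proof (induction M arbitrary: \<xi> \<eta>)
    case (Suc M)
    have "Q \<xi> \<eta> - poisson_gram (Suc M) \<xi> \<eta>
        = (\<Sum>i=1..n. Q (B i \<xi>) (B i \<eta>) - poisson_gram M (B i \<xi>) (B i \<eta>))"
      by (subst step) (simp add: sum_subtractf)
    then have "cmod (Q \<xi> \<eta> - poisson_gram (Suc M) \<xi> \<eta>)
        \<le> (\<Sum>i=1..n. r ^ M * ((Re (Q (B i \<xi>) (B i \<xi>)) + Re (Q (B i \<eta>) (B i \<eta>))) / 2))"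
      by (simp only:) (intro sum_norm_le Suc.IH)
    also have "\<dots> = r ^ M * (((\<Sum>i=1..n. Re (Q (B i \<xi>) (B i \<xi>))) + (\<Sum>i=1..n. Re (Q (B i \<eta>) (B i \<eta>)))) / 2)"
      by (simp only: sum_distrib_left[symmetric] sum_divide_distrib[symmetric] sum.distrib)
    also have "\<dots> \<le> r ^ M * ((r * Re (Q \<xi> \<xi>) + r * Re (Q \<eta> \<eta>)) / 2)"
      by (intro mult_left_mono divide_right_mono add_mono contr) (use r in auto)
    finally show ?case by (simp add: algebra_simps)
  qed (use bound in simp)
  have "(\<lambda>M. r ^ M * ((Re (Q \<xi> \<xi>) + Re (Q \<eta> \<eta>)) / 2)) \<longlonglongrightarrow> 0"
    by (intro tendsto_mult_left_zero LIMSEQ_realpow_zero r)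
  then have "(\<lambda>M. Q \<xi> \<eta> - poisson_gram M \<xi> \<eta>) \<longlonglongrightarrow> 0"
    by (rule tendsto_0_le[where K = 1]) (intro always_eventually allI, use order_trans[OF * abs_ge_self] in simp)
  then have "(\<lambda>M. Q \<xi> \<eta> - (Q \<xi> \<eta> - poisson_gram M \<xi> \<eta>)) \<longlonglongrightarrow> Q \<xi> \<eta> - 0"
    by (intro tendsto_diff tendsto_const)
  then show ?thesis by simp
qed

declare poisson.simps(2) [simp del]

text \<open>At every depth the compression is exactly a scalar multiple of 1, so limits are taken
  among complex numbers and never in the algebra. Wandering depth and truncation depth grow
  together, and \<open>Suc\<close> leaves one level for \<open>adj (S i)\<close> to strip.\<close>

definition compresses_to :: "'a \<Rightarrow> ('v \<Rightarrow> 'v \<Rightarrow> complex) \<Rightarrow> bool" where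
  "compresses_to x h \<longleftrightarrow> (\<exists>g.
     (\<forall>M \<xi> \<eta>. adj (poisson (Suc M) (Suc M) \<xi>) * x * poisson (Suc M) (Suc M) \<eta> = g M \<xi> \<eta> *\<^sub>C 1) \<and>
     (\<forall>\<xi> \<eta>. (\<lambda>M. g M \<xi> \<eta>) \<longlonglongrightarrow> h \<xi> \<eta>))"

lemma compresses_to_add:
  assumes "compresses_to x h" "compresses_to y k"
  shows "compresses_to (x + y) (\<lambda>\<xi> \<eta>. h \<xi> \<eta> + k \<xi> \<eta>)"
proof -
  obtain g g' where
    "\<forall>M \<xi> \<eta>. adj (poisson (Suc M) (Suc M) \<xi>) * x * poisson (Suc M) (Suc M) \<eta> = g M \<xi> \<eta> *\<^sub>C 1"
    "\<forall>\<xi> \<eta>. (\<lambda>M. g M \<xi> \<eta>) \<longlonglongrightarrow> h \<xi> \<eta>"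
    "\<forall>M \<xi> \<eta>. adj (poisson (Suc M) (Suc M) \<xi>) * y * poisson (Suc M) (Suc M) \<eta> = g' M \<xi> \<eta> *\<^sub>C 1"
    "\<forall>\<xi> \<eta>. (\<lambda>M. g' M \<xi> \<eta>) \<longlonglongrightarrow> k \<xi> \<eta>"
    using assms unfolding compresses_to_def by (elim exE conjE)
  then show ?thesis
    unfolding compresses_to_def
    by (intro exI[of _ "\<lambda>M \<xi> \<eta>. g M \<xi> \<eta> + g' M \<xi> \<eta>"])
       (auto simp: distrib_left distrib_right scaleC_add_left intro!: tendsto_add)
qed

lemma compresses_to_scaleC:
  assumes "compresses_to x h"
  shows "compresses_to (c *\<^sub>C x) (\<lambda>\<xi> \<eta>. c * h \<xi> \<eta>)"
proof -
  obtain g where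
    "\<forall>M \<xi> \<eta>. adj (poisson (Suc M) (Suc M) \<xi>) * x * poisson (Suc M) (Suc M) \<eta> = g M \<xi> \<eta> *\<^sub>C 1"
    "\<forall>\<xi> \<eta>. (\<lambda>M. g M \<xi> \<eta>) \<longlonglongrightarrow> h \<xi> \<eta>"
    using assms unfolding compresses_to_def by (elim exE conjE)
  then show ?thesis
    unfolding compresses_to_def
    by (intro exI[of _ "\<lambda>M \<xi> \<eta>. c * g M \<xi> \<eta>"])
       (auto simp: mult_scaleC_left mult_scaleC_right scaleC_scaleC intro!: tendsto_mult_left)
qed

lemma compresses_to_adj:
  assumes "compresses_to x h"
  shows "compresses_to (adj x) (\<lambda>\<xi> \<eta>. cnj (h \<eta> \<xi>))"
proof -
  obtain g where g:
    "\<forall>M \<xi> \<eta>. adj (poisson (Suc M) (Suc M) \<xi>) * x * poisson (Suc M) (Suc M) \<eta> = g M \<xi> \<eta> *\<^sub>C 1"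
    "\<forall>\<xi> \<eta>. (\<lambda>M. g M \<xi> \<eta>) \<longlonglongrightarrow> h \<xi> \<eta>"
    using assms unfolding compresses_to_def by (elim exE conjE)
  have "adj (poisson (Suc M) (Suc M) \<xi>) * adj x * poisson (Suc M) (Suc M) \<eta>
      = adj (adj (poisson (Suc M) (Suc M) \<eta>) * x * poisson (Suc M) (Suc M) \<xi>)" for M \<xi> \<eta>
    by (simp add: adj_mult adj_adj mult.assoc)
  then have "adj (poisson (Suc M) (Suc M) \<xi>) * adj x * poisson (Suc M) (Suc M) \<eta>
      = cnj (g M \<eta> \<xi>) *\<^sub>C 1" for M \<xi> \<eta>
    by (simp only: g(1)[rule_format]) (simp add: adj_scaleC)
  then show ?thesis
    unfolding compresses_to_def
    by (intro exI[of _ "\<lambda>M \<xi> \<eta>. cnj (g M \<eta> \<xi>)"]) (use g(2) in \<open>auto intro!: tendsto_cnj\<close>)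
qed

lemma compresses_to_one:
  assumes "\<And>\<xi> \<eta>. (\<lambda>M. poisson_gram M \<xi> \<eta>) \<longlonglongrightarrow> Q \<xi> \<eta>"
  shows "compresses_to 1 Q"
  unfolding compresses_to_def
  by (intro exI[of _ "\<lambda>M. poisson_gram (Suc M)"] conjI allI)
     (simp_all only: mult.right_neutral adj_poisson_mult_poisson min.idem order_refl LIMSEQ_Suc[OF assms])

lemma compresses_to_adj_isometry:
  assumes "\<And>\<xi> \<eta>. (\<lambda>M. poisson_gram M \<xi> \<eta>) \<longlonglongrightarrow> Q \<xi> \<eta>" "i \<in> {1..n}"
  shows "compresses_to (adj (S i)) (\<lambda>\<xi> \<eta>. Q \<xi> (B i \<eta>))"
  unfolding compresses_to_def
  by (intro exI[of _ "\<lambda>M \<xi> \<eta>. poisson_gram M \<xi> (B i \<eta>)"] conjI allI)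
     (simp_all only: poisson_isometry_poisson assms order_refl)

text \<open>At a fixed depth, with \<open>w k\<close> the kernel at \<open>\<xi> k\<close>, the
  double sum regroups as a sum of squares of the elements \<open>\<Sum>k. Y m k * w k\<close>, and
  it is a scalar. Nonnegativity then passes to the limit. The entries of \<open>Y\<close> themselves
  are not compressed.\<close>

lemma compression_nonneg:
  fixes q :: nat
  assumes h: "\<And>k l. k < q \<Longrightarrow> l < q \<Longrightarrow> compresses_to (\<Sum>m<q. adj (Y m k) * Y m l) (h k l)"
  shows "0 \<le> (\<Sum>k<q. \<Sum>l<q. h k l (\<xi> k) (\<xi> l))"
proof -
  define P where "P = (\<lambda>k l g.
       (\<forall>M. adj (poisson (Suc M) (Suc M) (\<xi> k)) * (\<Sum>m<q. adj (Y m k) * Y m l) * poisson (Suc M) (Suc M) (\<xi> l) = g M *\<^sub>C 1)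
       \<and> g \<longlonglongrightarrow> h k l (\<xi> k) (\<xi> l))"
  have ex: "\<exists>g. P k l g" if kl: "k < q" "l < q" for k l
  proof -
    obtain g where
      "\<forall>M \<xi> \<eta>. adj (poisson (Suc M) (Suc M) \<xi>) * (\<Sum>m<q. adj (Y m k) * Y m l) * poisson (Suc M) (Suc M) \<eta>
          = g M \<xi> \<eta> *\<^sub>C 1"
      "\<forall>\<xi> \<eta>. (\<lambda>M. g M \<xi> \<eta>) \<longlonglongrightarrow> h k l \<xi> \<eta>"
      using h[OF kl] unfolding compresses_to_def by (elim exE conjE)
    then have "P k l (\<lambda>M. g M (\<xi> k) (\<xi> l))" unfolding P_def by simp
    then show ?thesis by blast
  qed
  have "P k l (SOME g. P k l g)" if "k < q" "l < q" for k l
    using ex[OF that] by (rule someI_ex)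
  then obtain g where "\<And>k l. k < q \<Longrightarrow> l < q \<Longrightarrow> P k l (g k l)"
    by (rule that[of "\<lambda>k l. SOME g. P k l g"])
  then have g: "\<And>k l M. k < q \<Longrightarrow> l < q \<Longrightarrow>
       adj (poisson (Suc M) (Suc M) (\<xi> k)) * (\<Sum>m<q. adj (Y m k) * Y m l) * poisson (Suc M) (Suc M) (\<xi> l)
         = g k l M *\<^sub>C 1"
    "\<And>k l. k < q \<Longrightarrow> l < q \<Longrightarrow> (\<lambda>M. g k l M) \<longlonglongrightarrow> h k l (\<xi> k) (\<xi> l)"
    unfolding P_def by simp_all
  have nonneg: "0 \<le> (\<Sum>k<q. \<Sum>l<q. g k l M)" for M
  proof -
    define w where "w = (\<lambda>k. poisson (Suc M) (Suc M) (\<xi> k))"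
    have "(\<Sum>m<q. adj (\<Sum>k<q. Y m k * w k) * (\<Sum>l<q. Y m l * w l))
        = (\<Sum>m<q. \<Sum>k<q. \<Sum>l<q. adj (w k) * (adj (Y m k) * Y m l) * w l)"
      by (simp add: adj_sum adj_mult sum_product mult.assoc)
    also have "\<dots> = (\<Sum>k<q. \<Sum>l<q. \<Sum>m<q. adj (w k) * (adj (Y m k) * Y m l) * w l)"
      by (rule trans[OF sum.swap]) (intro sum.cong refl sum.swap)
    also have "\<dots> = (\<Sum>k<q. \<Sum>l<q. adj (w k) * (\<Sum>m<q. adj (Y m k) * Y m l) * w l)"
      by (simp only: sum_distrib_left sum_distrib_right)
    also have "\<dots> = (\<Sum>k<q. \<Sum>l<q. g k l M) *\<^sub>C 1"
      unfolding scaleC_sum_left w_def by (intro sum.cong refl g(1)) auto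
    finally show ?thesis
      by (rule sum_adj_mult_eq_scalar_nonneg)
  qed
  have lim: "(\<lambda>M. \<Sum>k<q. \<Sum>l<q. g k l M) \<longlonglongrightarrow> (\<Sum>k<q. \<Sum>l<q. h k l (\<xi> k) (\<xi> l))"
    by (intro tendsto_sum g(2)) auto
  have "0 \<le> Re (\<Sum>k<q. \<Sum>l<q. h k l (\<xi> k) (\<xi> l))"
    by (rule LIMSEQ_le_const[OF tendsto_Re[OF lim]]) (use nonneg in \<open>auto simp: less_eq_complex_def\<close>)
  moreover have "(\<lambda>M. 0) \<longlonglongrightarrow> Im (\<Sum>k<q. \<Sum>l<q. h k l (\<xi> k) (\<xi> l))"
    using tendsto_Im[OF lim] nonneg by (simp add: less_eq_complex_def)
  then have "Im (\<Sum>k<q. \<Sum>l<q. h k l (\<xi> k) (\<xi> l)) = 0" by (simp add: LIMSEQ_const_iff)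
  ultimately show ?thesis by (simp add: less_eq_complex_def)
qed

end

end

section \<open>Positive kernels\<close>

text \<open>Kernels on an arbitrary index set are used instead of matrices, so that matrices over
  matrices are simply kernels on pairs and index arithmetic is confined to one reindexing.\<close>

definition sesq :: "'i set \<Rightarrow> ('i \<Rightarrow> 'i \<Rightarrow> complex) \<Rightarrow> ('i \<Rightarrow> complex) \<Rightarrow> ('i \<Rightarrow> complex) \<Rightarrow> complex" where
  "sesq I h v w = (\<Sum>i\<in>I. \<Sum>j\<in>I. cnj (v i) * h i j * w j)"

definition pos_kernel :: "'i set \<Rightarrow> ('i \<Rightarrow> 'i \<Rightarrow> complex) \<Rightarrow> bool" where
  "pos_kernel I h \<longleftrightarrow> (\<forall>v. 0 \<le> sesq I h v v)"

lemma sesq_cong: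
  "(\<And>i j. i \<in> I \<Longrightarrow> j \<in> I \<Longrightarrow> h i j = h' i j) \<Longrightarrow> (\<And>i. i \<in> I \<Longrightarrow> v i = v' i) \<Longrightarrow>
    (\<And>i. i \<in> I \<Longrightarrow> w i = w' i) \<Longrightarrow> sesq I h v w = sesq I h' v' w'"
  unfolding sesq_def by (intro sum.cong refl) simp

lemma pos_kernel_cong:
  "(\<And>i j. i \<in> I \<Longrightarrow> j \<in> I \<Longrightarrow> h i j = h' i j) \<Longrightarrow> pos_kernel I h \<longleftrightarrow> pos_kernel I h'"
  unfolding pos_kernel_def by (simp cong: sesq_cong)

lemma pos_kernel_reindex:
  assumes "bij_betw f J I"
  shows "pos_kernel I h \<longleftrightarrow> pos_kernel J (\<lambda>i j. h (f i) (f j))"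
proof -
  have *: "sesq I h v v = sesq J (\<lambda>i j. h (f i) (f j)) (v \<circ> f) (v \<circ> f)" for v
    unfolding sesq_def by (simp add: sum.reindex_bij_betw[OF assms, symmetric])
  show ?thesis
  proof
    assume "pos_kernel J (\<lambda>i j. h (f i) (f j))"
    then show "pos_kernel I h" by (simp add: pos_kernel_def *)
  next
    assume h: "pos_kernel I h"
    show "pos_kernel J (\<lambda>i j. h (f i) (f j))"
      unfolding pos_kernel_def
    proof
      fix v
      have "sesq J (\<lambda>i j. h (f i) (f j)) v v = sesq I h (v \<circ> the_inv_into J f) (v \<circ> the_inv_into J f)"
        unfolding * by (rule sesq_cong) (use assms in \<open>auto simp: bij_betw_def the_inv_into_f_f\<close>)
      then show "0 \<le> sesq J (\<lambda>i j. h (f i) (f j)) v v" using h by (simp add: pos_kernel_def)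
    qed
  qed
qed

lemma pos_kernel_subset:
  fixes h :: "'i \<Rightarrow> 'i \<Rightarrow> complex"
  assumes "pos_kernel I h" "J \<subseteq> I" "finite I"
  shows "pos_kernel J h"
  unfolding pos_kernel_def
proof
  fix v :: "'i \<Rightarrow> complex"
  define w where "w = (\<lambda>i. if i \<in> J then v i else 0)"
  have "(\<Sum>j\<in>I. cnj (w i) * h i j * w j) = (\<Sum>j\<in>J. cnj (w i) * h i j * w j)" for i
    by (rule sum.mono_neutral_right) (use assms in \<open>auto simp: w_def\<close>)
  then have "sesq I h w w = (\<Sum>i\<in>I. \<Sum>j\<in>J. cnj (w i) * h i j * w j)" by (simp add: sesq_def)
  also have "\<dots> = sesq J h w w"
    unfolding sesq_def by (rule sum.mono_neutral_right) (use assms in \<open>auto simp: w_def\<close>)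
  also have "\<dots> = sesq J h v v" by (rule sesq_cong) (auto simp: w_def)
  finally have "sesq J h v v = sesq I h w w" by simp
  then show "0 \<le> sesq J h v v" using assms(1) unfolding pos_kernel_def by simp
qed

lemma pos_kernel_diag:
  assumes "pos_kernel I h" "finite I" "i \<in> I"
  shows "0 \<le> h i i"
proof -
  have "pos_kernel {i} h" by (rule pos_kernel_subset[OF assms(1) _ assms(2)]) (use assms in auto)
  then have "0 \<le> sesq {i} h (\<lambda>_. 1) (\<lambda>_. 1)" by (simp only: pos_kernel_def)
  then show ?thesis by (simp add: sesq_def)
qed

lemma pos_kernel_pair:
  assumes "pos_kernel I h" "finite I" "i \<in> I" "j \<in> I" "i \<noteq> j"
  shows "0 \<le> cnj \<alpha> * h i i * \<alpha> + cnj \<alpha> * h i j * \<beta> + cnj \<beta> * h j i * \<alpha> + cnj \<beta> * h j j * \<beta>"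
proof -
  have "pos_kernel {i, j} h" by (rule pos_kernel_subset[OF assms(1) _ assms(2)]) (use assms in auto)
  then have "0 \<le> sesq {i, j} h (\<lambda>k. if k = i then \<alpha> else \<beta>) (\<lambda>k. if k = i then \<alpha> else \<beta>)"
    by (simp only: pos_kernel_def)
  then show ?thesis using assms(5) by (simp add: sesq_def add.assoc)
qed

lemma pos_kernel_hermitian:
  assumes "pos_kernel I h" "finite I" "i \<in> I" "j \<in> I"
  shows "cnj (h i j) = h j i"
proof (cases "i = j")
  case True
  then show ?thesis using pos_kernel_diag[OF assms(1-3)] by (simp add: less_eq_complex_def complex_eq_iff)
next
  case False
  have "Im (h i i) = 0" "Im (h j j) = 0"
    using pos_kernel_diag[OF assms(1,2)] assms(3,4) by (auto simp: less_eq_complex_def)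
  \<comment> \<open>Nonnegativity in the complex order includes being real: the vector
    \<open>(1, 1)\<close> controls the imaginary parts of the off-diagonal entries, and
    \<open>(1, \<i>)\<close> their real parts.\<close>
  then show ?thesis
    using pos_kernel_pair[OF assms False, of 1 1] pos_kernel_pair[OF assms False, of 1 \<i>]
    by (simp add: less_eq_complex_def complex_eq_iff)
qed

lemma cnj_sesq:
  assumes "\<And>i j. i \<in> I \<Longrightarrow> j \<in> I \<Longrightarrow> cnj (h i j) = k j i"
  shows "cnj (sesq I h v w) = sesq I k w v"
proof -
  have "cnj (sesq I h v w) = (\<Sum>i\<in>I. \<Sum>j\<in>I. cnj (w j) * k j i * v i)"
    unfolding sesq_def by (simp add: assms mult_ac)
  also have "\<dots> = sesq I k w v" unfolding sesq_def by (rule sum.swap)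
  finally show ?thesis .
qed

lemma pos_kernel_row_0:
  assumes h: "pos_kernel I h" "finite I" and x: "x \<in> I" "h x x = 0" and j: "j \<in> I"
  shows "h x j = 0"
proof (cases "j = x")
  case False
  have r: "cnj (h x j) = h j x" by (rule pos_kernel_hermitian[OF h x(1) j])
  define m where "m = Re (h x j) * Re (h x j) + Im (h x j) * Im (h x j)"
  \<comment> \<open>The vector with entries \<open>- s * h x j\<close> at \<open>x\<close> and 1 at
    \<open>j\<close> has value \<open>h j j - 2 * s * m\<close>, which cannot stay nonnegative for
    all \<open>s\<close> unless \<open>m = 0\<close>.\<close>
  have *: "2 * s * m \<le> Re (h j j)" for s
    using pos_kernel_pair[OF h x(1) j False[symmetric], of "- (s * h x j)" 1]
    by (simp add: x(2) r[symmetric] less_eq_complex_def m_def algebra_simps)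
  have "m = 0"
  proof (rule ccontr)
    assume "m \<noteq> 0"
    then show False
      using *[of "(Re (h j j) + 1) / m"] pos_kernel_diag[OF h j] by (simp add: less_eq_complex_def)
  qed
  then show ?thesis by (simp add: m_def complex_eq_iff)
qed (use x in simp)

text \<open>Cholesky factorisation by induction on the index set: a zero diagonal entry forces a
  zero row, and otherwise one passes to the Schur complement. The factor \<open>D\<close> serves in
  place of a square root of the defect.\<close>

lemma pos_kernel_gram:
  assumes "finite I" "pos_kernel I h"
  shows "\<exists>(N::nat) D. \<forall>i\<in>I. \<forall>j\<in>I. h i j = (\<Sum>c<N. cnj (D i c) * D j c)"
  using assms
proof (induction I arbitrary: h rule: finite_induct)
  case (insert x I)
  note fin = finite.insertI[OF insert.hyps(1)]
  have herm: "cnj (h i j) = h j i" if "i \<in> insert x I" "j \<in> insert x I" for i j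
    by (rule pos_kernel_hermitian[OF insert.prems fin that])
  show ?case
  proof (cases "h x x = 0")
    case True
    have "pos_kernel I h" by (rule pos_kernel_subset[OF insert.prems _ fin]) auto
    then obtain N :: nat and D where D: "\<forall>i\<in>I. \<forall>j\<in>I. h i j = (\<Sum>c<N. cnj (D i c) * D j c)"
      using insert.IH by blast
    have 0: "h x j = 0" "h j x = 0" if "j \<in> insert x I" for j
      using pos_kernel_row_0[OF insert.prems fin _ True that] herm[of x j] that by auto
    have "\<forall>i\<in>insert x I. \<forall>j\<in>insert x I. h i j = (\<Sum>c<N. cnj ((D(x := \<lambda>_. 0)) i c) * (D(x := \<lambda>_. 0)) j c)"
      using D 0 insert.hyps(2) by auto
    then show ?thesis by blast
  next
    case False
    define d where "d = Re (h x x)"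
    have dx: "h x x = complex_of_real d" and d: "0 < d"
      using pos_kernel_diag[OF insert.prems fin, of x] False
      by (auto simp: d_def less_eq_complex_def complex_eq_iff)
    define k where "k = (\<lambda>i j. h i j - cnj (h x i) * h x j / d)"
    have "pos_kernel I k"
      unfolding pos_kernel_def
    proof
      fix v
      define s where "s = (\<Sum>j\<in>I. h x j * v j)"
      \<comment> \<open>Completing the square: \<open>- s / d\<close> is the value at
        \<open>x\<close> that minimises the form of \<open>h\<close>, and the minimum is the form of
        \<open>k\<close>.\<close>
      define w where "w = v(x := - s / d)"
      have vw: "w i = v i" if "i \<in> I" for i using that insert.hyps(2) by (auto simp: w_def)
      have s': "(\<Sum>i\<in>I. cnj (v i) * h i x) = cnj s"
        using herm by (simp add: s_def mult.commute)
      have "sesq (insert x I) h w w = cnj (w x) * h x x * w x + cnj (w x) * s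
          + (\<Sum>i\<in>I. cnj (v i) * h i x) * w x + sesq I h v v"
        using insert.hyps
        by (simp add: sesq_def sum.distrib vw s_def sum_distrib_left sum_distrib_right mult.assoc)
      also have "\<dots> = sesq I h v v - cnj s * s / d"
        using d by (simp add: s' dx w_def field_simps)
      also have "\<dots> = sesq I k v v"
      proof -
        have *: "cnj s * s / d = (\<Sum>i\<in>I. \<Sum>j\<in>I. cnj (v i) * (cnj (h x i) * h x j / d) * v j)"
          unfolding s_def cnj_sum complex_cnj_mult sum_product sum_divide_distrib
          by (intro sum.cong refl) simp
        show ?thesis
          unfolding * sesq_def k_def sum_subtractf[symmetric]
          by (intro sum.cong refl) (simp only: left_diff_distrib right_diff_distrib)
      qed
      finally have "sesq I k v v = sesq (insert x I) h w w" by simp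
      then show "0 \<le> sesq I k v v" using insert.prems unfolding pos_kernel_def by simp
    qed
    then obtain N :: nat and D where D: "\<forall>i\<in>I. \<forall>j\<in>I. k i j = (\<Sum>c<N. cnj (D i c) * D j c)"
      using insert.IH by blast
    \<comment> \<open>The coordinate \<open>N\<close> carries the rank-one part split off from
      \<open>h\<close>. The old coordinates of \<open>x\<close> are zeroed, since the complement
      \<open>k\<close> lives on \<open>I\<close> alone.\<close>
    define E where "E = (\<lambda>i c. if c < N then if i = x then 0 else D i c else h x i / sqrt d)"
    have sq: "complex_of_real (sqrt d) * complex_of_real (sqrt d) = d"
      using d by (simp flip: of_real_mult)
    have "h i j = (\<Sum>c<Suc N. cnj (E i c) * E j c)" if "i \<in> insert x I" "j \<in> insert x I" for i j
    proof (cases "i = x \<or> j = x")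
      case True
      then have "(\<Sum>c<N. cnj (E i c) * E j c) = 0" by (auto simp: E_def)
      then have "(\<Sum>c<Suc N. cnj (E i c) * E j c) = cnj (h x i) * h x j / d"
        by (simp add: E_def sq)
      also have "\<dots> = h i j" using True d herm[of x i] herm[of x x] that by (auto simp: dx)
      finally show ?thesis by simp
    next
      case False
      then have "(\<Sum>c<N. cnj (E i c) * E j c) = k i j" using D that by (simp add: E_def)
      then have "(\<Sum>c<Suc N. cnj (E i c) * E j c) = k i j + cnj (h x i) * h x j / d"
        by (simp add: E_def sq)
      then show ?thesis by (simp add: k_def)
    qed
    then show ?thesis by blast
  qed
qed simp

lemma sesq_gram:
  fixes N :: nat
  assumes "\<And>i j. i \<in> I \<Longrightarrow> j \<in> I \<Longrightarrow> h i j = (\<Sum>c<N. cnj (D i c) * D j c)"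
  shows "sesq I h v w = (\<Sum>c<N. cnj (\<Sum>i\<in>I. D i c * v i) * (\<Sum>j\<in>I. D j c * w j))"
proof -
  have "sesq I h v w = (\<Sum>i\<in>I. \<Sum>j\<in>I. \<Sum>c<N. (cnj (D i c) * cnj (v i)) * (D j c * w j))"
    unfolding sesq_def by (simp add: assms sum_distrib_left sum_distrib_right mult_ac)
  also have "\<dots> = (\<Sum>i\<in>I. \<Sum>c<N. \<Sum>j\<in>I. (cnj (D i c) * cnj (v i)) * (D j c * w j))"
    by (intro sum.cong refl sum.swap)
  also have "\<dots> = (\<Sum>c<N. \<Sum>i\<in>I. \<Sum>j\<in>I. (cnj (D i c) * cnj (v i)) * (D j c * w j))"
    by (rule sum.swap)
  finally show ?thesis by (simp add: sum_product)
qed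

text \<open>Cauchy-Schwarz combined with the arithmetic-geometric mean inequality. Being linear in
  the diagonal values, this form can be summed over the branches \<open>B i\<close> in the remainder
  estimate.\<close>

lemma cmod_sesq_le:
  assumes "finite I" "pos_kernel I h"
  shows "cmod (sesq I h v w) \<le> (Re (sesq I h v v) + Re (sesq I h w w)) / 2"
proof -
  obtain N :: nat and D where D: "\<forall>i\<in>I. \<forall>j\<in>I. h i j = (\<Sum>c<N. cnj (D i c) * D j c)"
    using pos_kernel_gram[OF assms] by blast
  define V where "V = (\<lambda>v c. \<Sum>i\<in>I. D i c * v i)"
  have g: "sesq I h v w = (\<Sum>c<N. cnj (V v c) * V w c)" for v w
    unfolding V_def by (rule sesq_gram) (use D in blast)
  have r: "Re (sesq I h v v) = (\<Sum>c<N. (cmod (V v c))\<^sup>2)" for v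
    unfolding g by (simp add: cmod_power2) (simp add: power2_eq_square)
  have "cmod (sesq I h v w) \<le> (\<Sum>c<N. ((cmod (V v c))\<^sup>2 + (cmod (V w c))\<^sup>2) / 2)"
    unfolding g
  proof (rule sum_norm_le)
    fix c
    show "cmod (cnj (V v c) * V w c) \<le> ((cmod (V v c))\<^sup>2 + (cmod (V w c))\<^sup>2) / 2"
      using sum_squares_bound[of "cmod (V v c)" "cmod (V w c)"] by (simp add: norm_mult)
  qed
  also have "\<dots> = (Re (sesq I h v v) + Re (sesq I h w w)) / 2"
    by (simp only: r sum_divide_distrib[symmetric] sum.distrib)
  finally show ?thesis .
qed

text \<open>A null vector of the matrix would make the form vanish, so the determinant is nonzero
  and the inverse gives \<open>b\<close> column by column.\<close>

lemma nondegenerate_solvable: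
  fixes q g :: "nat \<Rightarrow> nat \<Rightarrow> complex"
  assumes "\<And>v. (\<exists>a<p. v a \<noteq> 0) \<Longrightarrow> sesq {..<p} q v v \<noteq> 0"
  shows "\<exists>b. \<forall>a<p. \<forall>c. (\<Sum>k<p. q a k * b k c) = g a c"
proof -
  define A where "A = mat p p (\<lambda>(a, b). q a b)"
  have A: "A \<in> carrier_mat p p" by (simp add: A_def)
  have "det A \<noteq> 0"
  proof
    assume "det A = 0"
    then obtain v where v: "v \<in> carrier_vec p" "v \<noteq> 0\<^sub>v p" "A *\<^sub>v v = 0\<^sub>v p"
      using det_0_iff_vec_prod_zero_field[OF A] by auto
    have "(\<Sum>b<p. q a b * v $ b) = 0" if "a < p" for a
      using arg_cong[OF v(3), of "\<lambda>w. w $ a"] that v(1)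
      by (simp add: A_def scalar_prod_def atLeast0LessThan)
    then have "sesq {..<p} q (\<lambda>a. v $ a) (\<lambda>a. v $ a) = 0"
      by (simp add: sesq_def mult.assoc flip: sum_distrib_left)
    moreover have "\<exists>a<p. v $ a \<noteq> 0" using v(1,2) by (auto simp: vec_eq_iff)
    ultimately show False using assms by blast
  qed
  then have "A \<in> Units (ring_mat TYPE(complex) p ())" by (rule det_non_zero_imp_unit[OF A])
  then obtain B where B: "B \<in> carrier_mat p p" "A * B = 1\<^sub>m p"
    unfolding Units_def ring_mat_def by auto
  have "(\<Sum>k<p. q a k * (B *\<^sub>v vec p (\<lambda>l. g l c)) $ k) = g a c" if "a < p" for a c
  proof -
    have "A *\<^sub>v (B *\<^sub>v vec p (\<lambda>l. g l c)) = vec p (\<lambda>l. g l c)"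
      using A B by (simp flip: assoc_mult_mat_vec[OF A B(1)])
    from arg_cong[OF this, of "\<lambda>w. w $ a"] show ?thesis
      using that B(1) by (simp add: A_def scalar_prod_def atLeast0LessThan del: index_mult_mat_vec)
         (simp add: scalar_prod_def atLeast0LessThan A_def)
  qed
  then show ?thesis by (intro exI[of _ "\<lambda>k c. (B *\<^sub>v vec p (\<lambda>l. g l c)) $ k"]) simp
qed

section \<open>Block matrices as kernels on pairs, and rules for sesquilinear forms\<close>

lemma psd_iff_pos_kernel:
  assumes "A \<in> carrier_mat N N"
  shows "psd A \<longleftrightarrow> pos_kernel {..<N} (\<lambda>i j. A $$ (i, j))"
proof -
  have *: "(A *\<^sub>v v) \<bullet>c v = sesq {..<N} (\<lambda>i j. A $$ (i, j)) (\<lambda>i. v $ i) (\<lambda>i. v $ i)"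
    if "v \<in> carrier_vec N" for v
    using that assms
    by (simp add: sesq_def scalar_prod_def atLeast0LessThan sum_distrib_left sum_distrib_right mult_ac)
  show ?thesis
  proof
    assume psd: "psd A"
    show "pos_kernel {..<N} (\<lambda>i j. A $$ (i, j))"
      unfolding pos_kernel_def
    proof
      fix v :: "nat \<Rightarrow> complex"
      have "sesq {..<N} (\<lambda>i j. A $$ (i, j)) v v = (A *\<^sub>v vec N v) \<bullet>c vec N v"
        by (subst *) (auto intro!: sesq_cong)
      then show "0 \<le> sesq {..<N} (\<lambda>i j. A $$ (i, j)) v v" using psd assms by (simp add: psd_def)
    qed
  qed (use assms in \<open>simp add: psd_def pos_kernel_def *\<close>)
qed

lemma block_index_less: "a < p \<Longrightarrow> k < m \<Longrightarrow> a * m + k < p * (m::nat)"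
  using mult_le_mono1[of "Suc a" p m] by simp

lemma psd_block_mat_iff:
  assumes X: "X \<in> carrier_mat p p"
  shows "psd (block_mat m X) \<longleftrightarrow>
    pos_kernel ({..<p} \<times> {..<m}) (\<lambda>(a, k) (b, l). X $$ (a, b) $$ (k, l))"
proof -
  have "block_mat m X \<in> carrier_mat (p * m) (p * m)" using X by (auto simp: block_mat_def)
  then have "psd (block_mat m X) \<longleftrightarrow> pos_kernel {..<p * m} (\<lambda>i j. block_mat m X $$ (i, j))"
    by (rule psd_iff_pos_kernel)
  also have "\<dots> \<longleftrightarrow> pos_kernel ({..<p} \<times> {..<m})
      (\<lambda>x y. block_mat m X $$ (fst x * m + snd x, fst y * m + snd y))"
  proof (rule pos_kernel_reindex)
    show "bij_betw (\<lambda>x. fst x * m + snd x) ({..<p} \<times> {..<m}) {..<p * m}"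
    proof (rule bij_betwI[where g = "\<lambda>i. (i div m, i mod m)"])
      show "(\<lambda>x. fst x * m + snd x) \<in> {..<p} \<times> {..<m} \<rightarrow> {..<p * m}"
        by (auto intro: block_index_less)
      show "(\<lambda>i. (i div m, i mod m)) \<in> {..<p * m} \<rightarrow> {..<p} \<times> {..<m}"
        by (auto simp: less_mult_imp_div_less) (metis mod_less_divisor mult_0_right neq0_conv not_less0)
    qed auto
  qed
  also have "\<dots> \<longleftrightarrow> pos_kernel ({..<p} \<times> {..<m}) (\<lambda>(a, k) (b, l). X $$ (a, b) $$ (k, l))"
  proof (rule pos_kernel_cong, clarify)
    fix a b k l assume *: "a < p" "k < m" "b < p" "l < m"
    have "a * m + k < p * m" "b * m + l < p * m" using * by (auto intro: block_index_less)
    then show "block_mat m X $$ (fst (a, k) * m + snd (a, k), fst (b, l) * m + snd (b, l))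
        = X $$ (a, b) $$ (k, l)"
      using X * by (auto simp: block_mat_def)
  qed
  finally show ?thesis .
qed

text \<open>The canonical shuffle: applying theta to a matrix of functionals gives blocks of size
  \<open>n + 1\<close>, while evaluating that matrix at a matrix over the system gives blocks of
  size \<open>p\<close>.\<close>

lemma pos_kernel_swap:
  "pos_kernel (I \<times> K) (\<lambda>(a, k) (b, l). h a b k l) \<longleftrightarrow> pos_kernel (K \<times> I) (\<lambda>(k, a) (l, b). h a b k l)"
proof -
  have "bij_betw prod.swap (K \<times> I) (I \<times> K)" by (auto simp: bij_betw_def)
  from pos_kernel_reindex[OF this, of "\<lambda>(a, k) (b, l). h a b k l"] show ?thesis
    by (simp add: case_prod_unfold)
qed

lemma sesq_Times:
  "sesq (K \<times> I) (\<lambda>(k, a) (l, b). h a b k l) v w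
    = (\<Sum>k\<in>K. \<Sum>l\<in>K. sesq I (\<lambda>a b. h a b k l) (\<lambda>a. v (k, a)) (\<lambda>b. w (l, b)))"
proof -
  have "sesq (K \<times> I) (\<lambda>(k, a) (l, b). h a b k l) v w
      = (\<Sum>k\<in>K. \<Sum>a\<in>I. \<Sum>l\<in>K. \<Sum>b\<in>I. cnj (v (k, a)) * h a b k l * w (l, b))"
    by (simp add: sesq_def sum.cartesian_product')
  also have "\<dots> = (\<Sum>k\<in>K. \<Sum>l\<in>K. sesq I (\<lambda>a b. h a b k l) (\<lambda>a. v (k, a)) (\<lambda>b. w (l, b)))"
    unfolding sesq_def by (intro sum.cong refl sum.swap)
  finally show ?thesis .
qed

lemma sesq_minus: "sesq I h (\<lambda>i. - v i) w = - sesq I h v w" "sesq I h v (\<lambda>i. - w i) = - sesq I h v w"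
  by (simp_all add: sesq_def sum_negf)

lemma sesq_zero [simp]: "sesq I h (\<lambda>_. 0) w = 0" "sesq I h v (\<lambda>_. 0) = 0" "sesq I (\<lambda>_ _. 0) v w = 0"
  by (simp_all add: sesq_def)

lemma sesq_add_kernel: "sesq I (\<lambda>i j. h i j + k i j) v w = sesq I h v w + sesq I k v w"
  by (simp add: sesq_def sum.distrib algebra_simps)

lemma sesq_scale_kernel: "sesq I (\<lambda>i j. c * h i j) v w = c * sesq I h v w"
  by (simp add: sesq_def sum_distrib_left mult_ac)

lemma sesq_diff_kernel: "sesq I (\<lambda>i j. h i j - k i j) v w = sesq I h v w - sesq I k v w"
  by (simp add: sesq_def sum_subtractf algebra_simps)

lemma sesq_sum_kernel: "sesq I (\<lambda>i j. \<Sum>c\<in>C. h c i j) v w = (\<Sum>c\<in>C. sesq I (h c) v w)"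
  by (induction C rule: infinite_finite_induct) (simp_all add: sesq_add_kernel)

lemma sesq_id_kernel:
  assumes "finite I"
  shows "sesq I (\<lambda>i j. if i = j then c else 0) v v = c * complex_of_real (\<Sum>i\<in>I. (cmod (v i))\<^sup>2)"
proof -
  have "sesq I (\<lambda>i j. if i = j then c else 0) v v = (\<Sum>i\<in>I. \<Sum>j\<in>I. if i = j then cnj (v i) * c * v j else 0)"
    unfolding sesq_def by (intro sum.cong refl) simp
  also have "\<dots> = (\<Sum>i\<in>I. c * (v i * cnj (v i)))"
    using assms by (simp add: mult_ac)
  finally show ?thesis by (simp add: complex_norm_square[symmetric] sum_distrib_left)
qed

lemma Re_sesq_le:
  assumes "finite I"
  shows "Re (sesq I h v v) \<le> (\<Sum>i\<in>I. \<Sum>j\<in>I. cmod (h i j)) * (\<Sum>i\<in>I. (cmod (v i))\<^sup>2)"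
proof -
  define R where "R = (\<Sum>i\<in>I. (cmod (v i))\<^sup>2)"
  have R: "(cmod (v i))\<^sup>2 \<le> R" if "i \<in> I" for i
    unfolding R_def by (rule member_le_sum) (use that assms in auto)
  have "cmod (sesq I h v v) \<le> (\<Sum>i\<in>I. \<Sum>j\<in>I. cmod (h i j) * R)"
    unfolding sesq_def
  proof (intro sum_norm_le)
    fix i j assume ij: "i \<in> I" "j \<in> I"
    have "2 * (cmod (v i) * cmod (v j)) \<le> (cmod (v i))\<^sup>2 + (cmod (v j))\<^sup>2"
      using sum_squares_bound[of "cmod (v i)" "cmod (v j)"] by simp
    then have "cmod (v i) * cmod (v j) \<le> R" using R[OF ij(1)] R[OF ij(2)] by linarith
    then have "cmod (h i j) * (cmod (v i) * cmod (v j)) \<le> cmod (h i j) * R" by (intro mult_left_mono) auto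
    then show "cmod (cnj (v i) * h i j * v j) \<le> cmod (h i j) * R" by (simp add: norm_mult mult_ac)
  qed
  then show ?thesis
    using complex_Re_le_cmod[of "sesq I h v v"] by (simp add: R_def sum_distrib_right)
qed

section \<open>Positivity of maps on the Cuntz system\<close>

context cuntz_family
begin

text \<open>The positive element of \<open>M\<^sub>n\<^sub>+\<^sub>1(S\<^sub>n)\<close> with first row \<open>1, S\<^sub>1, \<dots>, S\<^sub>n\<close>.\<close>

definition entry :: "nat \<Rightarrow> nat \<Rightarrow> 'a" where
  "entry k l = (if k = l then 1 else if k = 0 then S l else if l = 0 then adj (S k) else 0)"

text \<open>The gap \<open>\<epsilon>\<close> is used twice. On vectors supported in block 0 it
  bounds \<open>q\<close> below, so the equations for \<open>B\<close> are solvable. On vectors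
  \<open>(v, - B_1 v, ..., - B_n v)\<close> it bounds the Schur complement below, which yields the
  contraction factor of the Poisson series.\<close>

lemma generators_compress_strict:
  fixes F :: "nat \<Rightarrow> nat \<Rightarrow> 'a \<Rightarrow> complex"
  assumes pos: "pos_kernel ({..n} \<times> {..<p})
      (\<lambda>(k, a) (l, b). F a b (entry k l) - (if k = l then if a = b then complex_of_real \<epsilon> else 0 else 0))"
    and \<epsilon>: "0 < \<epsilon>" and F0: "\<And>a b. a < p \<Longrightarrow> b < p \<Longrightarrow> F a b 0 = 0"
  shows "\<exists>(N::nat) D B. \<forall>x \<in> {1} \<union> S ` {1..n} \<union> (\<lambda>i. adj (S i)) ` {1..n}.
    compresses_to N D B x (sesq {..<p} (\<lambda>a b. F a b x))"
proof -
  define q where "q = sesq {..<p} (\<lambda>a b. F a b 1)"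
  define A where "A = (\<lambda>i. sesq {..<p} (\<lambda>a b. F a b (adj (S i))))"
  define A' where "A' = (\<lambda>i. sesq {..<p} (\<lambda>a b. F a b (S i)))"
  define nrm where "nrm = (\<lambda>v. \<Sum>a<p. (cmod (v a))\<^sup>2)"
  have nrm_nonneg: "0 \<le> nrm v" for v by (simp add: nrm_def sum_nonneg)
  have herm: "cnj (F a b (entry k l)) = F b a (entry l k)" if "a < p" "b < p" "k \<le> n" "l \<le> n" for a b k l
    using pos_kernel_hermitian[OF pos, of "(k, a)" "(l, b)"] that by (auto split: if_splits)
  have q_herm: "cnj (q v w) = q w v" for v w
    unfolding q_def by (rule cnj_sesq) (use herm[of _ _ 0 0] in \<open>simp add: entry_def\<close>)
  have A_herm: "cnj (A i v w) = A' i w v" if "i \<in> {1..n}" for i v w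
    unfolding A_def A'_def by (rule cnj_sesq) (use herm[of _ _ i 0] that in \<open>simp add: entry_def\<close>)
  have main: "0 \<le> q (V 0) (V 0) - \<epsilon> * nrm (V 0)
      + (\<Sum>k=1..n. A' k (V 0) (V k) + A k (V k) (V 0) + q (V k) (V k) - \<epsilon> * nrm (V k))" for V :: "nat \<Rightarrow> nat \<Rightarrow> complex"
  proof -
    define T where "T = (\<lambda>k l. sesq {..<p} (\<lambda>a b. F a b (entry k l)
       - (if k = l then if a = b then complex_of_real \<epsilon> else 0 else 0)) (V k) (V l))"
    have T: "T k l = (if k = l then q (V k) (V k) - \<epsilon> * nrm (V k) else if k = 0 then A' l (V k) (V l)
       else if l = 0 then A k (V k) (V l) else 0)" for k l
    proof -
      have "sesq {..<p} (\<lambda>a b. F a b 0) v w = 0" for v w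
        using sesq_cong[of "{..<p}" "\<lambda>a b. F a b 0" "\<lambda>_ _. 0" v v w w] F0 by simp
      then show ?thesis
        by (simp add: T_def entry_def q_def A_def A'_def nrm_def sesq_diff_kernel sesq_id_kernel)
    qed
    have "0 \<le> (\<Sum>k\<le>n. \<Sum>l\<le>n. T k l)"
      using pos[unfolded pos_kernel_def, THEN spec, of "\<lambda>(k, a). V k a"]
      unfolding sesq_Times[where h = "\<lambda>a b k l. F a b (entry k l) - (if k = l then if a = b then complex_of_real \<epsilon> else 0 else 0)"]
      by (simp add: T_def)
    also have "{..n} = insert 0 {1..n}" by auto
    also have "(\<Sum>k\<in>insert 0 {1..n}. \<Sum>l\<in>insert 0 {1..n}. T k l)
       = T 0 0 + (\<Sum>k=1..n. T 0 k) + (\<Sum>k=1..n. T k 0 + (\<Sum>l=1..n. T k l))" by simp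
    also have "\<dots> = T 0 0 + (\<Sum>k=1..n. T 0 k) + (\<Sum>k=1..n. T k 0 + T k k)"
    proof -
      have "(\<Sum>l=1..n. T k l) = T k k" if "k \<in> {1..n}" for k
      proof -
        have "(\<Sum>l=1..n. T k l) = (\<Sum>l=1..n. if k = l then T k l else 0)"
          by (intro sum.cong refl) (use that T in auto)
        then show ?thesis using that by simp
      qed
      then show ?thesis by simp
    qed
    also have "\<dots> = T 0 0 + (\<Sum>k=1..n. T 0 k + T k 0 + T k k)"
      by (simp add: sum.distrib)
    also have "\<dots> = q (V 0) (V 0) - \<epsilon> * nrm (V 0)
      + (\<Sum>k=1..n. A' k (V 0) (V k) + A k (V k) (V 0) + q (V k) (V k) - \<epsilon> * nrm (V k))"
      by (intro arg_cong2[of _ _ _ _ "(+)"] sum.cong refl) (auto simp: T)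
    finally show ?thesis .
  qed
  have q_pos: "complex_of_real (\<epsilon> * nrm v) \<le> q v v" for v
    using main[of "\<lambda>k. if k = 0 then v else (\<lambda>_. 0)"]
    by (simp add: q_def A_def A'_def nrm_def)
  have "\<exists>b. \<forall>a<p. \<forall>c. (\<Sum>k<p. F a k 1 * b k c) = F a c (adj (S i))" for i
  proof (rule nondegenerate_solvable)
    fix v assume v: "\<exists>a<p. v a \<noteq> (0::complex)"
    then obtain a where "a < p" "v a \<noteq> 0" by blast
    then have "0 < nrm v" unfolding nrm_def by (intro sum_pos2[of _ a]) auto
    then have "0 < \<epsilon> * nrm v" using \<epsilon> by simp
    then show "sesq {..<p} (\<lambda>a k. F a k 1) v v \<noteq> 0"
      using q_pos[of v] by (auto simp: q_def less_eq_complex_def)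
  qed
  then obtain b where b: "\<And>i a c. a < p \<Longrightarrow> (\<Sum>k<p. F a k 1 * b i k c) = F a c (adj (S i))"
    by metis
  define B where "B = (\<lambda>i \<eta> k. \<Sum>c<p. b i k c * \<eta> c :: complex)"
  have qB: "q \<xi> (B i \<eta>) = A i \<xi> \<eta>" for i \<xi> \<eta>
  proof -
    have "(\<Sum>k<p. F a k 1 * B i \<eta> k) = (\<Sum>c<p. F a c (adj (S i)) * \<eta> c)" if "a < p" for a
    proof -
      have "(\<Sum>k<p. F a k 1 * B i \<eta> k) = (\<Sum>k<p. \<Sum>c<p. F a k 1 * b i k c * \<eta> c)"
        by (simp add: B_def sum_distrib_left mult.assoc)
      also have "\<dots> = (\<Sum>c<p. (\<Sum>k<p. F a k 1 * b i k c) * \<eta> c)"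
        unfolding sum_distrib_right by (rule sum.swap)
      finally show ?thesis by (simp add: b[OF that])
    qed
    then show ?thesis by (simp add: q_def A_def sesq_def mult.assoc flip: sum_distrib_left)
  qed
  \<comment> \<open>Because \<open>q \<xi> (B i \<eta>) = A i \<xi> \<eta>\<close>, the product
    \<open>adj (B i) A (B i)\<close> can be written with the values at \<open>adj (S i)\<close> in
    place of its last two factors.\<close>
  define \<Delta> where "\<Delta> = (\<lambda>a c. F a c 1 - (\<Sum>i=1..n. \<Sum>k<p. cnj (b i k a) * F k c (adj (S i))))"
  have AB: "A i (B i \<xi>) \<eta> = sesq {..<p} (\<lambda>a c. \<Sum>k<p. cnj (b i k a) * F k c (adj (S i))) \<xi> \<eta>" for i \<xi> \<eta>
  proof -
    have "A i (B i \<xi>) \<eta> = (\<Sum>k<p. \<Sum>c<p. \<Sum>a<p. cnj (\<xi> a) * (cnj (b i k a) * F k c (adj (S i))) * \<eta> c)"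
      by (simp add: A_def B_def sesq_def sum_distrib_left sum_distrib_right mult_ac)
    also have "\<dots> = (\<Sum>k<p. \<Sum>a<p. \<Sum>c<p. cnj (\<xi> a) * (cnj (b i k a) * F k c (adj (S i))) * \<eta> c)"
      by (intro sum.cong refl sum.swap)
    also have "\<dots> = (\<Sum>a<p. \<Sum>k<p. \<Sum>c<p. cnj (\<xi> a) * (cnj (b i k a) * F k c (adj (S i))) * \<eta> c)"
      by (rule sum.swap)
    also have "\<dots> = (\<Sum>a<p. \<Sum>c<p. \<Sum>k<p. cnj (\<xi> a) * (cnj (b i k a) * F k c (adj (S i))) * \<eta> c)"
      by (intro sum.cong refl sum.swap)
    finally show ?thesis by (simp add: sesq_def sum_distrib_left sum_distrib_right)
  qed
  have \<Delta>: "sesq {..<p} \<Delta> \<xi> \<eta> = q \<xi> \<eta> - (\<Sum>i=1..n. q (B i \<xi>) (B i \<eta>))" for \<xi> \<eta>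
    unfolding \<Delta>_def sesq_diff_kernel qB AB
    by (intro arg_cong2[of _ _ _ _ "(-)"] sesq_sum_kernel) (simp add: q_def)
  have gap: "complex_of_real (\<epsilon> * nrm v) \<le> q v v - (\<Sum>i=1..n. q (B i v) (B i v))" for v
  proof -
    have *: "A' i v (B i v) = q (B i v) (B i v)" if "i \<in> {1..n}" for i
      using A_herm[OF that, of "B i v" v] by (simp add: qB[symmetric] q_herm)
    have "0 \<le> q v v - \<epsilon> * nrm v + (\<Sum>k=1..n. - q (B k v) (B k v) - \<epsilon> * nrm (B k v))"
    proof -
      \<comment> \<open>This vector realises the Schur complement: both mixed terms contribute
        \<open>- q (B k v) (B k v)\<close> and the diagonal term gives one of them back.\<close>
      define V where "V = (\<lambda>k. if k = 0 then v else (\<lambda>a. - B k v a))"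
      have V0: "V 0 = v" by (simp add: V_def)
      have "(\<Sum>k=1..n. A' k (V 0) (V k) + A k (V k) (V 0) + q (V k) (V k) - \<epsilon> * nrm (V k))
          = (\<Sum>k=1..n. - q (B k v) (B k v) - \<epsilon> * nrm (B k v))"
      proof (intro sum.cong refl)
        fix k assume k: "k \<in> {1..n}"
        then have Vk: "V k = (\<lambda>a. - B k v a)" by (simp add: V_def)
        have "A' k v (\<lambda>a. - B k v a) = - q (B k v) (B k v)"
          using *[OF k] by (simp add: A'_def sesq_minus)
        moreover have "A k (\<lambda>a. - B k v a) v = - q (B k v) (B k v)"
          using qB[of "B k v" k v] by (simp add: A_def sesq_minus)
        moreover have "q (\<lambda>a. - B k v a) (\<lambda>a. - B k v a) = q (B k v) (B k v)"
          by (simp add: q_def sesq_minus)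
        ultimately show "A' k (V 0) (V k) + A k (V k) (V 0) + q (V k) (V k) - \<epsilon> * nrm (V k)
            = - q (B k v) (B k v) - \<epsilon> * nrm (B k v)"
          unfolding V0 Vk by (simp add: nrm_def)
      qed
      then show ?thesis using main[of V] unfolding V0 by simp
    qed
    also have "\<dots> = q v v - (\<Sum>i=1..n. q (B i v) (B i v)) - complex_of_real (\<epsilon> * nrm v + (\<Sum>k=1..n. \<epsilon> * nrm (B k v)))"
      by (simp add: sum_subtractf sum_negf)
    finally have "complex_of_real (\<epsilon> * nrm v + (\<Sum>k=1..n. \<epsilon> * nrm (B k v))) \<le> q v v - (\<Sum>i=1..n. q (B i v) (B i v))"
      by simp
    moreover have "complex_of_real (\<epsilon> * nrm v) \<le> complex_of_real (\<epsilon> * nrm v + (\<Sum>k=1..n. \<epsilon> * nrm (B k v)))"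
      using \<epsilon> nrm_nonneg by (simp add: less_eq_complex_def sum_nonneg)
    ultimately show ?thesis by (rule order_trans[rotated])
  qed
  have "pos_kernel {..<p} \<Delta>"
    unfolding pos_kernel_def \<Delta>
  proof
    fix v
    have "0 \<le> complex_of_real (\<epsilon> * nrm v)" using \<epsilon> nrm_nonneg[of v] by (simp add: less_eq_complex_def)
    then show "0 \<le> q v v - (\<Sum>i=1..n. q (B i v) (B i v))" using gap[of v] by (rule order_trans)
  qed
  then obtain N :: nat and d where d: "\<forall>a\<in>{..<p}. \<forall>c\<in>{..<p}. \<Delta> a c = (\<Sum>m<N. cnj (d a m) * d c m)"
    using pos_kernel_gram[of "{..<p}" \<Delta>] by blast
  define D where "D = (\<lambda>\<xi> m. \<Sum>a<p. d a m * \<xi> a)"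
  have step: "q \<xi> \<eta> = (\<Sum>m<N. cnj (D \<xi> m) * D \<eta> m) + (\<Sum>i=1..n. q (B i \<xi>) (B i \<eta>))" for \<xi> \<eta>
  proof -
    have "sesq {..<p} \<Delta> \<xi> \<eta> = (\<Sum>m<N. cnj (D \<xi> m) * D \<eta> m)"
      unfolding D_def by (rule sesq_gram) (use d in blast)
    then show ?thesis unfolding \<Delta> by (simp only: diff_eq_eq)
  qed
  have "pos_kernel {..<p} (\<lambda>a b. F a b 1)"
    unfolding pos_kernel_def q_def[symmetric]
  proof
    fix v
    have "0 \<le> complex_of_real (\<epsilon> * nrm v)" using \<epsilon> nrm_nonneg[of v] by (simp add: less_eq_complex_def)
    then show "0 \<le> q v v" using q_pos[of v] by (rule order_trans)
  qed
  then have bound: "cmod (q \<xi> \<eta>) \<le> (Re (q \<xi> \<xi>) + Re (q \<eta> \<eta>)) / 2" for \<xi> \<eta>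
    unfolding q_def by (rule cmod_sesq_le[rotated]) simp
  \<comment> \<open>The double sum gives \<open>q v v \<le> C * nrm v\<close>, turning the absolute
    gap \<open>\<epsilon> * nrm v\<close> into the fraction \<open>\<epsilon> / C\<close> of
    \<open>q v v\<close>. The summand \<open>\<epsilon>\<close> ensures that
    \<open>1 - \<epsilon> / C\<close> lies in \<open>[0, 1)\<close>.\<close>
  define C where "C = \<epsilon> + (\<Sum>a<p. \<Sum>b<p. cmod (F a b 1))"
  have C: "\<epsilon> \<le> C" by (simp add: C_def sum_nonneg)
  have qC: "Re (q v v) \<le> C * nrm v" for v
  proof -
    have "Re (q v v) \<le> (\<Sum>a<p. \<Sum>b<p. cmod (F a b 1)) * nrm v"
      unfolding q_def nrm_def by (rule Re_sesq_le) simp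
    also have "\<dots> \<le> C * nrm v" using \<epsilon> nrm_nonneg by (intro mult_right_mono) (auto simp: C_def)
    finally show ?thesis .
  qed
  have contr: "(\<Sum>i=1..n. Re (q (B i v) (B i v))) \<le> (1 - \<epsilon> / C) * Re (q v v)" for v
  proof -
    have "\<epsilon> / C * Re (q v v) \<le> \<epsilon> / C * (C * nrm v)"
      using qC \<epsilon> C by (intro mult_left_mono) auto
    also have "\<dots> = \<epsilon> * nrm v" using \<epsilon> C by simp
    also have "\<dots> \<le> Re (q v v) - (\<Sum>i=1..n. Re (q (B i v) (B i v)))"
      using gap[of v] by (simp add: less_eq_complex_def)
    finally show ?thesis by (simp add: algebra_simps)
  qed
  have lim: "(\<lambda>M. poisson_gram N D B M \<xi> \<eta>) \<longlonglongrightarrow> q \<xi> \<eta>" for \<xi> \<eta>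
    by (rule poisson_gram_tendsto[where Q = q and N = N and D = D and B = B and r = "1 - \<epsilon> / C"])
       (fact step, fact bound, fact contr, use \<epsilon> C in auto)
  have one: "compresses_to N D B 1 q" by (rule compresses_to_one[where N = N and D = D and B = B and Q = q, OF lim])
  have adjS: "compresses_to N D B (adj (S i)) (A i)" if "i \<in> {1..n}" for i
    using compresses_to_adj_isometry[where N = N and D = D and B = B and Q = q, OF lim that] by (simp add: qB)
  have "compresses_to N D B (S i) (A' i)" if "i \<in> {1..n}" for i
    using compresses_to_adj[OF adjS[OF that]] by (simp add: A_herm[OF that] adj_adj)
  then show ?thesis using one adjS by (intro exI[of _ N] exI[of _ D] exI[of _ B]) (auto simp: q_def A_def A'_def)
qed

end

section \<open>Spans in matrix ordered spaces\<close>

lemma span_in_least: "G \<subseteq> T \<Longrightarrow> subspace_of V T \<Longrightarrow> span_in V G \<subseteq> T"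
  unfolding span_in_def by (rule hull_minimal)

lemma span_in_inc: "x \<in> G \<Longrightarrow> x \<in> span_in V G"
  unfolding span_in_def by (rule hull_inc)

text \<open>The hull is an intersection of subspaces. The carrier is one of them, which keeps the
  intersection inside it, and a generator makes it nonempty.\<close>

lemma subspace_of_span_in:
  assumes "subspace_of V (carr V)" "G \<subseteq> carr V" "G \<noteq> {}"
  shows "subspace_of V (span_in V G)"
  unfolding subspace_of_def
proof (intro conjI ballI allI)
  show "span_in V G \<subseteq> carr V" by (rule span_in_least[OF assms(2,1)])
  show "span_in V G \<noteq> {}" using assms(3) span_in_inc by fast
next
  fix x y assume "x \<in> span_in V G" "y \<in> span_in V G"
  then show "vadd V x y \<in> span_in V G"
    unfolding span_in_def hull_def by (auto simp: subspace_of_def)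
next
  fix c x assume "x \<in> span_in V G"
  then show "vsmult V c x \<in> span_in V G"
    unfolding span_in_def hull_def by (auto simp: subspace_of_def)
qed

lemma span_in_induct [consumes 4, case_names gen add smult]:
  assumes V: "subspace_of V (carr V)" "G \<subseteq> carr V" "G \<noteq> {}"
    and x: "x \<in> span_in V G"
    and "\<And>g. g \<in> G \<Longrightarrow> P g"
    and "\<And>x y. x \<in> span_in V G \<Longrightarrow> y \<in> span_in V G \<Longrightarrow> P x \<Longrightarrow> P y \<Longrightarrow> P (vadd V x y)"
    and "\<And>c x. x \<in> span_in V G \<Longrightarrow> P x \<Longrightarrow> P (vsmult V c x)"
  shows "P x"
proof -
  have "span_in V G \<subseteq> {x \<in> span_in V G. P x}"
  proof (rule span_in_least)
    show G: "G \<subseteq> {x \<in> span_in V G. P x}" using assms(5) span_in_inc by fast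
    show "subspace_of V {x \<in> span_in V G. P x}"
      using subspace_of_span_in[OF V] G assms(3,6,7) by (auto simp: subspace_of_def)
  qed
  then show ?thesis using x by blast
qed

section \<open>The Cuntz operator system and its dual\<close>

context cuntz_family
begin

abbreviation gens :: "'a set" where
  "gens \<equiv> {1} \<union> S ` {1..n} \<union> (\<lambda>i. adj (S i)) ` {1..n}"

abbreviation system :: "'a set" where "system \<equiv> carr (cuntz_system n S)"

lemma cuntz_algebra_mem:
  "1 \<in> cuntz_algebra n S" "i \<in> {1..n} \<Longrightarrow> S i \<in> cuntz_algebra n S"
  "x \<in> cuntz_algebra n S \<Longrightarrow> adj x \<in> cuntz_algebra n S"
  "x \<in> cuntz_algebra n S \<Longrightarrow> y \<in> cuntz_algebra n S \<Longrightarrow> x + y \<in> cuntz_algebra n S"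
  "x \<in> cuntz_algebra n S \<Longrightarrow> c *\<^sub>C x \<in> cuntz_algebra n S"
  unfolding cuntz_algebra_def hull_def by (auto simp: cstar_subalgebra_def)

lemma system_eq: "system = span_in (cstar_system (cuntz_algebra n S)) gens"
  by (simp add: cuntz_system_def subsystem_def)

lemma system_ops: "vadd (cuntz_system n S) = (+)" "vsmult (cuntz_system n S) = (*\<^sub>C)"
  by (simp_all add: cuntz_system_def subsystem_def cstar_system_def)

lemma cuntz_algebra_subspace:
  "subspace_of (cstar_system (cuntz_algebra n S)) (carr (cstar_system (cuntz_algebra n S)))"
  "gens \<subseteq> carr (cstar_system (cuntz_algebra n S))" "gens \<noteq> {}"
  by (auto simp: subspace_of_def cstar_system_def cuntz_algebra_mem intro: cuntz_algebra_mem(1))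

lemma system_subspace: "subspace_of (cstar_system (cuntz_algebra n S)) system"
  unfolding system_eq by (rule subspace_of_span_in[OF cuntz_algebra_subspace])

lemma system_gen: "g \<in> gens \<Longrightarrow> g \<in> system"
  unfolding system_eq by (rule span_in_inc)

lemma system_add: "x \<in> system \<Longrightarrow> y \<in> system \<Longrightarrow> x + y \<in> system"
  and system_scaleC: "x \<in> system \<Longrightarrow> c *\<^sub>C x \<in> system"
  using system_subspace by (auto simp: subspace_of_def cstar_system_def)

lemma system_entry: "k \<le> n \<Longrightarrow> l \<le> n \<Longrightarrow> entry k l \<in> system"
  using system_gen[of 1] system_scaleC[of 1 0] system_gen[of "S l"] system_gen[of "adj (S k)"]
  by (auto simp: entry_def)

lemma system_induct [consumes 1, case_names gen add smult]:
  assumes "x \<in> system"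
    and "\<And>g. g \<in> gens \<Longrightarrow> P g"
    and "\<And>x y. x \<in> system \<Longrightarrow> y \<in> system \<Longrightarrow> P x \<Longrightarrow> P y \<Longrightarrow> P (x + y)"
    and "\<And>c x. x \<in> system \<Longrightarrow> P x \<Longrightarrow> P (c *\<^sub>C x)"
  shows "P x"
proof (rule span_in_induct[OF cuntz_algebra_subspace, folded system_eq])
  show "P (vadd (cstar_system (cuntz_algebra n S)) x y)" if "x \<in> system" "y \<in> system" "P x" "P y" for x y
    using assms(3)[OF that] by (simp add: cstar_system_def)
  show "P (vsmult (cstar_system (cuntz_algebra n S)) c x)" if "x \<in> system" "P x" for c x
    using assms(4)[OF that] by (simp add: cstar_system_def)
qed (fact assms(1,2))+

lemma dual_space_iff:
  "f \<in> dual_space (cuntz_system n S) \<longleftrightarrow> f \<in> extensional system \<and>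
     (\<forall>x\<in>system. \<forall>y\<in>system. f (x + y) = f x + f y) \<and> (\<forall>c. \<forall>x\<in>system. f (c *\<^sub>C x) = c * f x)"
  by (simp add: dual_space_def system_ops)

lemma dual_space_add: "f \<in> dual_space (cuntz_system n S) \<Longrightarrow> x \<in> system \<Longrightarrow> y \<in> system \<Longrightarrow> f (x + y) = f x + f y"
  and dual_space_scaleC: "f \<in> dual_space (cuntz_system n S) \<Longrightarrow> x \<in> system \<Longrightarrow> f (c *\<^sub>C x) = c * f x"
  by (simp_all add: dual_space_iff)

lemma dual_space_zero: "f \<in> dual_space (cuntz_system n S) \<Longrightarrow> f 0 = 0"
  using dual_space_scaleC[of f 1 0] system_gen[of 1] by simp

lemma dual_space_eqI:
  assumes f: "f \<in> dual_space (cuntz_system n S)" and g: "g \<in> dual_space (cuntz_system n S)"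
    and eq: "\<And>x. x \<in> gens \<Longrightarrow> f x = g x"
  shows "f = g"
proof (rule extensionalityI)
  show "f \<in> extensional system" "g \<in> extensional system" using f g by (auto simp: dual_space_iff)
  show "f x = g x" if "x \<in> system" for x
    using that
    by (induction rule: system_induct) (simp_all add: eq dual_space_add[OF f] dual_space_add[OF g]
        dual_space_scaleC[OF f] dual_space_scaleC[OF g])
qed

lemma dual_space_plus:
  assumes "f \<in> dual_space (cuntz_system n S)" "g \<in> dual_space (cuntz_system n S)"
  shows "(\<lambda>x\<in>system. f x + g x) \<in> dual_space (cuntz_system n S)"
  using assms by (auto simp: dual_space_iff system_add system_scaleC algebra_simps)

lemma dual_space_smult:
  assumes "f \<in> dual_space (cuntz_system n S)"
  shows "(\<lambda>x\<in>system. c * f x) \<in> dual_space (cuntz_system n S)"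
  using assms by (auto simp: dual_space_iff system_add system_scaleC algebra_simps)

text \<open>The coordinate functionals compress by the vector \<open>wander 2 0\<close>, which is orthogonal to its
  translates by words of length one and two.\<close>

lemma coordinate_functional:
  assumes "\<And>g. g \<in> gens \<Longrightarrow> adj (wander 2 0) * (u * g * w) * wander 2 0 = h g *\<^sub>C 1"
  shows "\<exists>f \<in> dual_space (cuntz_system n S). \<forall>g\<in>gens. f g = h g"
proof -
  define Z where "Z = (\<lambda>x. adj (wander 2 0) * (u * x * w) * wander 2 0)"
  \<comment> \<open>The compression maps generators, hence by linearity the whole system, to
    multiples of 1. \<open>f\<close> reads off the coefficient, which is unique because 1 is
    nonzero.\<close>
  define f where "f = (\<lambda>x\<in>system. THE c. Z x = c *\<^sub>C 1)"
  have Z: "Z (x + y) = Z x + Z y" "Z (c *\<^sub>C x) = c *\<^sub>C Z x" for x y c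
    by (simp_all add: Z_def distrib_left distrib_right mult_scaleC_left mult_scaleC_right)
  have f: "f x = c" if "x \<in> system" "Z x = c *\<^sub>C 1" for x c
    using that by (simp add: f_def)
  have ex: "Z x = f x *\<^sub>C 1" if "x \<in> system" for x
  proof -
    have "\<exists>c. Z x = c *\<^sub>C 1"
      using that
    proof (induction rule: system_induct)
      case (gen g)
      then show ?case using assms[of g] by (auto simp: Z_def)
    next
      case (add x y)
      then show ?case by (metis Z(1) scaleC_add_left)
    next
      case (smult c x)
      then show ?case by (metis Z(2) scaleC_scaleC)
    qed
    then show ?thesis using f[OF that] by auto
  qed
  have "f \<in> dual_space (cuntz_system n S)"
    unfolding dual_space_iff
  proof (intro conjI ballI allI)
    show "f \<in> extensional system" by (simp add: f_def)
    show "f (x + y) = f x + f y" if "x \<in> system" "y \<in> system" for x y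
      by (rule f) (use that in \<open>simp_all add: system_add Z ex scaleC_add_left\<close>)
    show "f (c *\<^sub>C x) = c * f x" if "x \<in> system" for x c
      by (rule f) (use that in \<open>simp_all add: system_scaleC Z ex scaleC_scaleC\<close>)
  qed
  moreover have "f g = h g" if "g \<in> gens" for g
    by (rule f[OF system_gen[OF that]]) (simp add: Z_def assms[OF that])
  ultimately show ?thesis by blast
qed

lemma wander_compress:
  "adj (wander 2 0) * (1 * wander 2 0) = 1"
  "i \<in> {1..n} \<Longrightarrow> adj (wander 2 0) * (S i * wander 2 0) = 0"
  "i \<in> {1..n} \<Longrightarrow> j \<in> {1..n} \<Longrightarrow> adj (wander 2 0) * (S i * (S j * wander 2 0)) = 0"
  using wander_orthonormal[of 2 0 0] wander_word_wander[of "[i]" 2 0 0] wander_word_wander[of "[i, j]" 2 0 0]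
  by (auto simp: mult.assoc)

lemma wander_compress_adj:
  "i \<in> {1..n} \<Longrightarrow> adj (wander 2 0) * (adj (S i) * wander 2 0) = 0"
  "i \<in> {1..n} \<Longrightarrow> j \<in> {1..n} \<Longrightarrow> adj (wander 2 0) * (adj (S i) * (adj (S j) * wander 2 0)) = 0"
  using arg_cong[OF wander_compress(2)[of i], of adj] arg_cong[OF wander_compress(3)[of j i], of adj]
  by (auto simp: adj_mult adj_adj mult.assoc)

lemma adj_isometry_mult:
  "i \<in> {1..n} \<Longrightarrow> j \<in> {1..n} \<Longrightarrow> adj (S i) * (S j * x) = (if i = j then x else 0)"
  by (simp add: mult.assoc[symmetric] adj_mult_isometries)

text \<open>The coordinate functionals below are prescribed by equality tests such as
  \<open>g = S j\<close>, so the generators must be known to be pairwise distinct.\<close>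

lemma gens_distinct:
  assumes i: "i \<in> {1..n}"
  shows "S i \<noteq> 1" "adj (S i) \<noteq> 1"
proof -
  show "S i \<noteq> 1" using wander_compress(1) wander_compress(2)[OF i] by auto
  then show "adj (S i) \<noteq> 1" by (metis adj_adj adj_one)
qed

lemma gens_distinct':
  assumes i: "i \<in> {1..n}" and j: "j \<in> {1..n}"
  shows "S i = S j \<longleftrightarrow> i = j" "adj (S i) = adj (S j) \<longleftrightarrow> i = j" "S i \<noteq> adj (S j)"
proof -
  show S: "S i = S j \<longleftrightarrow> i = j" using adj_mult_isometries[OF i j] isometry[OF j] by (auto split: if_splits)
  show "adj (S i) = adj (S j) \<longleftrightarrow> i = j" using S by (metis adj_adj)
  show "S i \<noteq> adj (S j)"
  proof
    assume "S i = adj (S j)"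
    \<comment> \<open>Multiplied by \<open>adj (S i)\<close> and compressed, the left side gives 1,
      whereas the right side is the adjoint of a word of length two and gives 0.\<close>
    then have "adj (wander 2 0) * (adj (S i) * (S i * wander 2 0)) = adj (wander 2 0) * (adj (S i) * (adj (S j) * wander 2 0))"
      by simp
    then show False
      using wander_compress_adj(2)[OF i j] wander_compress(1) by (simp add: adj_isometry_mult[OF i i])
  qed
qed

text \<open>This amounts to the linear independence of the generators, proved by exhibiting the
  coordinate functionals.\<close>

lemma cuntz_dual_basis_exists: "\<exists>\<delta>0 \<delta> \<delta>s. cuntz_dual_basis n S \<delta>0 \<delta> \<delta>s"
proof -
  have "\<exists>f \<in> dual_space (cuntz_system n S). \<forall>g\<in>gens. f g = (if g = 1 then 1 else 0)"
    by (rule coordinate_functional[of 1 1])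
       (use wander_compress wander_compress_adj in \<open>auto simp: mult.assoc gens_distinct\<close>)
  then obtain \<delta>0 where \<delta>0: "\<delta>0 \<in> dual_space (cuntz_system n S)" "\<And>g. g \<in> gens \<Longrightarrow> \<delta>0 g = (if g = 1 then 1 else 0)"
    by blast
  have "\<forall>j\<in>{1..n}. \<exists>f \<in> dual_space (cuntz_system n S). \<forall>g\<in>gens. f g = (if g = S j then 1 else 0)"
  proof
    fix j assume j: "j \<in> {1..n}"
    show "\<exists>f \<in> dual_space (cuntz_system n S). \<forall>g\<in>gens. f g = (if g = S j then 1 else 0)"
      \<comment> \<open>The left factor \<open>adj (S j)\<close> turns \<open>S j\<close> into 1 and
        each other generator into 0 or the adjoint of a word of length one or two, which the
        compression annihilates.\<close>
      by (rule coordinate_functional[of "adj (S j)" 1])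
         (use j wander_compress wander_compress_adj gens_distinct[OF j]
          in \<open>auto simp: mult.assoc gens_distinct' adj_isometry_mult gens_distinct'(3)[symmetric]\<close>)
  qed
  then obtain \<delta> where \<delta>: "\<And>j. j \<in> {1..n} \<Longrightarrow> \<delta> j \<in> dual_space (cuntz_system n S)"
    "\<And>j g. j \<in> {1..n} \<Longrightarrow> g \<in> gens \<Longrightarrow> \<delta> j g = (if g = S j then 1 else 0)"
    by metis
  have "\<forall>j\<in>{1..n}. \<exists>f \<in> dual_space (cuntz_system n S). \<forall>g\<in>gens. f g = (if g = adj (S j) then 1 else 0)"
  proof
    fix j assume j: "j \<in> {1..n}"
    show "\<exists>f \<in> dual_space (cuntz_system n S). \<forall>g\<in>gens. f g = (if g = adj (S j) then 1 else 0)"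
      \<comment> \<open>Symmetrically, the right factor \<open>S j\<close> turns
        \<open>adj (S j)\<close> into 1 and the other generators into 0 or words of length one or
        two.\<close>
      by (rule coordinate_functional[of 1 "S j"])
         (use j wander_compress wander_compress_adj gens_distinct[OF j]
          in \<open>auto simp: mult.assoc gens_distinct' adj_isometry_mult\<close>)
  qed
  then obtain \<delta>s where \<delta>s: "\<And>j. j \<in> {1..n} \<Longrightarrow> \<delta>s j \<in> dual_space (cuntz_system n S)"
    "\<And>j g. j \<in> {1..n} \<Longrightarrow> g \<in> gens \<Longrightarrow> \<delta>s j g = (if g = adj (S j) then 1 else 0)"
    by metis
  have "cuntz_dual_basis n S \<delta>0 \<delta> \<delta>s"
    unfolding cuntz_dual_basis_def
    using \<delta>0 \<delta> \<delta>s gens_distinct gens_distinct' by (auto simp: eq_commute[of "adj _" "S _"] eq_commute[of 1])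
  then show ?thesis by blast
qed

text \<open>Compressibility is preserved by sums and scalar multiples, so the generators settle the
  whole system. The form at \<open>v\<close> is then the limit obtained with the vectors
  \<open>v (k, _)\<close>.\<close>

lemma sum_adj_mult_pos_kernel_strict:
  fixes F :: "nat \<Rightarrow> nat \<Rightarrow> 'a \<Rightarrow> complex"
  assumes F: "\<And>a b. a < p \<Longrightarrow> b < p \<Longrightarrow> F a b \<in> dual_space (cuntz_system n S)"
    and pos: "pos_kernel ({..n} \<times> {..<p})
      (\<lambda>(k, a) (l, b). F a b (entry k l) - (if k = l then if a = b then complex_of_real \<epsilon> else 0 else 0))"
    and \<epsilon>: "0 < \<epsilon>"
    and X: "\<And>k l. k < q \<Longrightarrow> l < q \<Longrightarrow> X k l = (\<Sum>m<q. adj (Y m k) * Y m l)"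
      "\<And>k l. k < q \<Longrightarrow> l < q \<Longrightarrow> X k l \<in> system"
  shows "pos_kernel ({..<q::nat} \<times> {..<p}) (\<lambda>(k, a) (l, b). F a b (X k l))"
proof -
  obtain N :: nat and D B where gen: "\<forall>x \<in> gens. compresses_to N D B x (sesq {..<p} (\<lambda>a b. F a b x))"
    using generators_compress_strict[OF pos \<epsilon>] F dual_space_zero by blast
  have comp: "compresses_to N D B x (sesq {..<p} (\<lambda>a b. F a b x))" if "x \<in> system" for x
    using that
  proof (induction rule: system_induct)
    case (gen g)
    then show ?case using \<open>\<forall>x \<in> gens. _ x\<close> by blast
  next
    case (add x y)
    have "(\<lambda>\<xi> \<eta>. sesq {..<p} (\<lambda>a b. F a b x) \<xi> \<eta> + sesq {..<p} (\<lambda>a b. F a b y) \<xi> \<eta>)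
        = sesq {..<p} (\<lambda>a b. F a b (x + y))"
      unfolding sesq_add_kernel[symmetric]
      by (intro ext sesq_cong refl) (use add F in \<open>simp add: dual_space_add\<close>)
    then show ?case using compresses_to_add[OF add.IH] by simp
  next
    case (smult c x)
    have "(\<lambda>\<xi> \<eta>. c * sesq {..<p} (\<lambda>a b. F a b x) \<xi> \<eta>) = sesq {..<p} (\<lambda>a b. F a b (c *\<^sub>C x))"
      unfolding sesq_scale_kernel[symmetric]
      by (intro ext sesq_cong refl) (use smult F in \<open>simp add: dual_space_scaleC\<close>)
    then show ?case using compresses_to_scaleC[OF smult.IH, of c] by simp
  qed
  show ?thesis
    unfolding pos_kernel_def sesq_Times
  proof
    fix v :: "nat \<times> nat \<Rightarrow> complex"
    show "0 \<le> (\<Sum>k<q. \<Sum>l<q. sesq {..<p} (\<lambda>a b. F a b (X k l)) (\<lambda>a. v (k, a)) (\<lambda>b. v (l, b)))"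
      by (rule compression_nonneg[where Y = Y and N = N and D = D and B = B])
         (use comp X in \<open>simp flip: X(1)\<close>)
  qed
qed

text \<open>\<open>\<delta>0\<close> is 1 on the diagonal of \<open>entry\<close> and 0 off it, so
  adding \<open>\<epsilon> * \<delta>0\<close> to the diagonal of \<open>F\<close> creates exactly
  the gap required by the strict version. The resulting form is affine in
  \<open>\<epsilon>\<close>.\<close>

lemma sum_adj_mult_pos_kernel:
  fixes F :: "nat \<Rightarrow> nat \<Rightarrow> 'a \<Rightarrow> complex"
  assumes F: "\<And>a b. a < p \<Longrightarrow> b < p \<Longrightarrow> F a b \<in> dual_space (cuntz_system n S)"
    and pos: "pos_kernel ({..n} \<times> {..<p}) (\<lambda>(k, a) (l, b). F a b (entry k l))"
    and X: "\<And>k l. k < q \<Longrightarrow> l < q \<Longrightarrow> X k l = (\<Sum>m<q. adj (Y m k) * Y m l)"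
      "\<And>k l. k < q \<Longrightarrow> l < q \<Longrightarrow> X k l \<in> system"
  shows "pos_kernel ({..<q::nat} \<times> {..<p}) (\<lambda>(k, a) (l, b). F a b (X k l))"
  unfolding pos_kernel_def
proof
  fix v
  obtain \<delta>0 \<delta> \<delta>s where "cuntz_dual_basis n S \<delta>0 \<delta> \<delta>s" using cuntz_dual_basis_exists by blast
  then have \<delta>0: "\<delta>0 \<in> dual_space (cuntz_system n S)" "\<delta>0 1 = 1"
    "\<And>j. j \<in> {1..n} \<Longrightarrow> \<delta>0 (S j) = 0" "\<And>j. j \<in> {1..n} \<Longrightarrow> \<delta>0 (adj (S j)) = 0"
    by (auto simp: cuntz_dual_basis_def)
  define z where "z = sesq ({..<q} \<times> {..<p}) (\<lambda>(k, a) (l, b). F a b (X k l)) v v"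
  define w where "w = sesq ({..<q} \<times> {..<p}) (\<lambda>(k, a) (l, b). if a = b then \<delta>0 (X k l) else 0) v v"
  have *: "0 \<le> z + complex_of_real \<epsilon> * w" if \<epsilon>: "0 < \<epsilon>" for \<epsilon>
  proof -
    define G where "G = (\<lambda>a b. \<lambda>x\<in>system. F a b x + (if a = b then complex_of_real \<epsilon> else 0) * \<delta>0 x)"
    have "pos_kernel ({..<q} \<times> {..<p}) (\<lambda>(k, a) (l, b). G a b (X k l))"
    proof (rule sum_adj_mult_pos_kernel_strict[OF _ _ \<epsilon> X])
      show "G a b \<in> dual_space (cuntz_system n S)" if "a < p" "b < p" for a b
      proof -
        have "G a b = (\<lambda>x\<in>system. F a b x + (\<lambda>x\<in>system. (if a = b then complex_of_real \<epsilon> else 0) * \<delta>0 x) x)"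
          by (auto simp: G_def restrict_def)
        then show ?thesis using dual_space_plus[OF F[OF that] dual_space_smult[OF \<delta>0(1)]] by simp
      qed
      have "\<delta>0 (entry k l) = (if k = l then 1 else 0)" if "k \<le> n" "l \<le> n" for k l
        using \<delta>0 dual_space_zero[OF \<delta>0(1)] that by (auto simp: entry_def)
      then show "pos_kernel ({..n} \<times> {..<p}) (\<lambda>(k, a) (l, b). G a b (entry k l)
          - (if k = l then if a = b then complex_of_real \<epsilon> else 0 else 0))"
        by (intro pos_kernel_cong[THEN iffD1, OF _ pos]) (auto simp: G_def system_entry)
    qed
    then have "0 \<le> sesq ({..<q} \<times> {..<p}) (\<lambda>(k, a) (l, b). G a b (X k l)) v v"
      by (simp only: pos_kernel_def)
    also have "\<dots> = sesq ({..<q} \<times> {..<p}) (\<lambda>i j. (\<lambda>(k, a) (l, b). F a b (X k l)) i j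
        + complex_of_real \<epsilon> * (\<lambda>(k, a) (l, b). if a = b then \<delta>0 (X k l) else 0) i j) v v"
      by (rule sesq_cong) (auto simp: G_def X(2))
    also have "\<dots> = z + complex_of_real \<epsilon> * w"
      unfolding z_def w_def by (simp only: sesq_add_kernel sesq_scale_kernel)
    finally show ?thesis .
  qed
  \<comment> \<open>Two values of \<open>\<epsilon>\<close> determine the affine imaginary part; the
    limit at 0 is then only about real parts.\<close>
  have "Im z + Im w = 0" "Im z + 2 * Im w = 0"
    using *[of 1] *[of 2] by (auto simp: less_eq_complex_def)
  then have im: "Im z = 0" by simp
  have lim: "((\<lambda>\<epsilon>. Re z + \<epsilon> * Re w) \<longlongrightarrow> Re z + 0 * Re w) (at_right 0)"
    by (intro tendsto_intros)
  have "0 \<le> Re z + 0 * Re w"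
    by (rule tendsto_lowerbound[OF lim])
       (use * in \<open>auto simp: less_eq_complex_def eventually_at_right_less intro!: eventually_at_rightI[of 0 1]\<close>)
  then show "0 \<le> sesq ({..<q} \<times> {..<p}) (\<lambda>(k, a) (l, b). F a b (X k l)) v v"
    using im by (simp add: z_def less_eq_complex_def)
qed

end

section \<open>The complete order isomorphism\<close>

context cuntz_family
begin

abbreviation dual :: "('a \<Rightarrow> complex) set" where "dual \<equiv> dual_space (cuntz_system n S)"

definition theta :: "('a \<Rightarrow> complex) \<Rightarrow> complex mat" where
  "theta f = mat (n + 1) (n + 1) (\<lambda>(k, l). f (entry k l))"

lemma theta_index: "k \<le> n \<Longrightarrow> l \<le> n \<Longrightarrow> theta f $$ (k, l) = f (entry k l)"
  by (simp add: theta_def)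

lemma theta_carrier: "theta f \<in> carrier_mat (n + 1) (n + 1)"
  by (simp add: theta_def)

lemma entry_gen: "entry k k = 1" "0 < i \<Longrightarrow> entry 0 i = S i" "0 < i \<Longrightarrow> entry i 0 = adj (S i)"
  by (simp_all add: entry_def)

lemma theta_eq_iff:
  assumes f: "f \<in> dual" and g: "g \<in> dual"
  shows "theta f = theta g \<longleftrightarrow> f = g"
proof
  assume eq: "theta f = theta g"
  have "f (entry k l) = g (entry k l)" if "k \<le> n" "l \<le> n" for k l
    using arg_cong[OF eq, of "\<lambda>A. A $$ (k, l)"] that by (simp add: theta_index)
  from this[of 0 0] this[of 0] this[of _ 0]
  have "f 1 = g 1" "i \<in> {1..n} \<Longrightarrow> f (S i) = g (S i) \<and> f (adj (S i)) = g (adj (S i))" for i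
    by (force simp: entry_gen)+
  then show "f = g" by (intro dual_space_eqI[OF f g]) auto
qed simp

lemma theta_plus:
  "f \<in> dual \<Longrightarrow> g \<in> dual \<Longrightarrow> theta (\<lambda>x\<in>system. f x + g x) = theta f + theta g"
  by (rule eq_matI) (auto simp: theta_def system_entry)

lemma theta_smult: "f \<in> dual \<Longrightarrow> theta (\<lambda>x\<in>system. c * f x) = c \<cdot>\<^sub>m theta f"
  by (rule eq_matI) (auto simp: theta_def system_entry)

abbreviation E_gens :: "complex mat set" where
  "E_gens \<equiv> {1\<^sub>m (n + 1)} \<union> (\<lambda>i. matrix_unit (n + 1) i 0) ` {1..n} \<union> (\<lambda>i. matrix_unit (n + 1) 0 i) ` {1..n}"

lemma E_carr: "carr (E' n) = span_in (matrix_algebra (n + 1)) E_gens"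
  by (simp add: E'_def subsystem_def)

lemma matrix_algebra_subspace:
  "subspace_of (matrix_algebra (n + 1)) (carr (matrix_algebra (n + 1)))"
  "E_gens \<subseteq> carr (matrix_algebra (n + 1))" "E_gens \<noteq> {}"
  by (auto simp: subspace_of_def matrix_algebra_def matrix_unit_def intro: zero_carrier_mat)

lemma E_subspace: "subspace_of (matrix_algebra (n + 1)) (carr (E' n))"
  unfolding E_carr by (rule subspace_of_span_in[OF matrix_algebra_subspace])

lemma E_gen: "A \<in> E_gens \<Longrightarrow> A \<in> carr (E' n)"
  unfolding E_carr by (rule span_in_inc)

lemma E_add: "A \<in> carr (E' n) \<Longrightarrow> B \<in> carr (E' n) \<Longrightarrow> A + B \<in> carr (E' n)"
  and E_smult: "A \<in> carr (E' n) \<Longrightarrow> c \<cdot>\<^sub>m A \<in> carr (E' n)"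
  using E_subspace by (auto simp: subspace_of_def matrix_algebra_def)

lemma E_ops: "vadd (E' n) = (+)" "vsmult (E' n) = (\<cdot>\<^sub>m)" "vunit (E' n) = 1\<^sub>m (n + 1)"
  by (simp_all add: E'_def subsystem_def matrix_algebra_def)

lemma theta_mem_E:
  assumes f: "f \<in> dual"
  shows "theta f \<in> carr (E' n)"
proof -
  \<comment> \<open>\<open>A m\<close> has the full diagonal but the border only up to index
    \<open>m\<close>, so each step adds two multiples of matrix units and only binary sums
    occur.\<close>
  define A where "A = (\<lambda>m. mat (n + 1) (n + 1)
    (\<lambda>(k, l). if k = l \<or> k \<le> m \<and> l \<le> m then f (entry k l) else 0))"
  have "A m \<in> carr (E' n)" if "m \<le> n" for m
    using that
  proof (induction m)
    case 0
    have "A 0 = f 1 \<cdot>\<^sub>m 1\<^sub>m (n + 1)" by (rule eq_matI) (auto simp: A_def entry_def)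
    moreover have "1\<^sub>m (n + 1) \<in> carr (E' n)" by (rule E_gen) simp
    ultimately show ?case by (simp add: E_smult)
  next
    case (Suc m)
    have "A (Suc m) = A m + (f (S (Suc m)) \<cdot>\<^sub>m matrix_unit (n + 1) 0 (Suc m)
        + f (adj (S (Suc m))) \<cdot>\<^sub>m matrix_unit (n + 1) (Suc m) 0)"
      using dual_space_zero[OF f] by (intro eq_matI) (auto simp: A_def matrix_unit_def entry_def le_Suc_eq)
    moreover have "matrix_unit (n + 1) 0 (Suc m) \<in> carr (E' n)" "matrix_unit (n + 1) (Suc m) 0 \<in> carr (E' n)"
      by (rule E_gen, use Suc.prems in force)+
    ultimately show ?case using Suc by (simp add: E_add E_smult)
  qed
  moreover have "theta f = A n" by (rule eq_matI) (auto simp: theta_def A_def)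
  ultimately show ?thesis by simp
qed

lemma elements_mat_subset_iff:
  "A \<in> carrier_mat r c \<Longrightarrow> elements_mat A \<subseteq> U \<longleftrightarrow> (\<forall>i<r. \<forall>j<c. A $$ (i, j) \<in> U)"
  by auto

lemma mcone_matrix_algebra:
  "X \<in> mcone (matrix_algebra p) q \<longleftrightarrow>
    X \<in> carrier_mat q q \<and> (\<forall>k<q. \<forall>l<q. X $$ (k, l) \<in> carrier_mat p p) \<and> psd (block_mat p X)"
  by (auto simp: matrix_algebra_def elements_mat_subset_iff)

lemma mcone_E:
  "X \<in> mcone (E' n) p \<longleftrightarrow>
    X \<in> carrier_mat p p \<and> (\<forall>a<p. \<forall>b<p. X $$ (a, b) \<in> carr (E' n)) \<and> psd (block_mat (n + 1) X)"
proof -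
  have "carr (E' n) \<subseteq> carrier_mat (n + 1) (n + 1)"
    using E_subspace by (simp add: subspace_of_def matrix_algebra_def)
  moreover have "X \<in> mcone (E' n) p \<longleftrightarrow> X \<in> mcone (matrix_algebra (n + 1)) p \<and> elements_mat X \<subseteq> carr (E' n)"
    by (simp add: E'_def subsystem_def)
  ultimately show ?thesis by (auto simp: mcone_matrix_algebra elements_mat_subset_iff)
qed

lemma mcone_system:
  "X \<in> mcone (cuntz_system n S) q \<longleftrightarrow> elements_mat X \<subseteq> system \<and>
    (\<exists>Y \<in> carrier_mat q q. elements_mat Y \<subseteq> cuntz_algebra n S \<and> X = Defs.adj_mat Y * Y)"
  by (auto simp: cuntz_system_def subsystem_def cstar_system_def)

lemma adj_mat_mult_index:
  assumes "Y \<in> carrier_mat q q" "k < q" "l < q"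
  shows "(Defs.adj_mat Y * Y) $$ (k, l) = (\<Sum>m<q. adj (Y $$ (m, k)) * Y $$ (m, l))"
  using assms by (simp add: Defs.adj_mat_def scalar_prod_def atLeast0LessThan)

text \<open>With \<open>R = (S\<^sub>1, \<dots>, S\<^sub>n)\<close> a row coisometry, the matrix with first row \<open>(1, R)\<close> and first
  column \<open>(1, R\<^sup>*)\<close> is the square of \<open>(R\<^sup>*, I)\<close>.\<close>

lemma entry_mat_mem_mcone: "mat (n + 1) (n + 1) (\<lambda>(k, l). entry k l) \<in> mcone (cuntz_system n S) (n + 1)"
proof -
  \<comment> \<open>Row 0 is zero padding, since the cone is made of products with a square
    \<open>Y\<close>.\<close>
  define Y where "Y = mat (n + 1) (n + 1)
    (\<lambda>(m, k). if m = 0 then 0 else if k = 0 then adj (S m) else if k = m then 1 else (0::'a))"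
  have Y: "Y \<in> carrier_mat (n + 1) (n + 1)" by (simp add: Y_def)
  have "0 \<in> cuntz_algebra n S" using cuntz_algebra_mem(5)[of 1 0] cuntz_algebra_mem(1) by simp
  then have "elements_mat Y \<subseteq> cuntz_algebra n S"
    by (auto simp: elements_mat_subset_iff[OF Y] Y_def cuntz_algebra_mem)
  moreover have "mat (n + 1) (n + 1) (\<lambda>(k, l). entry k l) = Defs.adj_mat Y * Y"
  proof (rule eq_matI)
    fix k l assume "k < dim_row (Defs.adj_mat Y * Y)" "l < dim_col (Defs.adj_mat Y * Y)"
    then have kl: "k \<le> n" "l \<le> n" by (auto simp: Y_def Defs.adj_mat_def)
    have "(Defs.adj_mat Y * Y) $$ (k, l) = (\<Sum>m<n + 1. adj (Y $$ (m, k)) * Y $$ (m, l))"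
      using kl by (intro adj_mat_mult_index[OF Y]) auto
    also have "{..<n + 1} = insert 0 {1..n}" by auto
    also have "(\<Sum>m\<in>insert 0 {1..n}. adj (Y $$ (m, k)) * Y $$ (m, l))
        = (\<Sum>m=1..n. (if k = 0 then S m else if k = m then 1 else 0) * (if l = 0 then adj (S m) else if l = m then 1 else 0))"
      using kl by (simp add: Y_def) (intro sum.cong refl, auto simp: adj_adj)
    also have "\<dots> = entry k l"
    proof (cases "k = 0 \<and> l = 0")
      case True
      then show ?thesis using range_projections_sum by (simp add: entry_def)
    next
      case False
      \<comment> \<open>Outside the corner at least one Kronecker factor is present, and it leaves
        \<open>m = c\<close> as the only possible contribution.\<close>
      define c where "c = (if k = 0 then l else k)"
      have c: "c \<in> {1..n}" using False kl by (auto simp: c_def)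
      have "(\<Sum>m=1..n. (if k = 0 then S m else if k = m then 1 else 0) * (if l = 0 then adj (S m) else if l = m then 1 else 0))
          = (\<Sum>m=1..n. if m = c then entry k l else 0)"
        using False by (intro sum.cong refl) (auto simp: c_def entry_def)
      then show ?thesis using c by simp
    qed
    finally show "mat (n + 1) (n + 1) (\<lambda>(k, l). entry k l) $$ (k, l) = (Defs.adj_mat Y * Y) $$ (k, l)"
      using kl by simp
  qed (auto simp: Y_def Defs.adj_mat_def)
  moreover have "elements_mat (mat (n + 1) (n + 1) (\<lambda>(k, l). entry k l)) \<subseteq> system"
    by (subst elements_mat_subset_iff[OF mat_carrier]) (simp add: system_entry)
  ultimately show ?thesis using Y unfolding mcone_system by blast
qed

text \<open>The matrix \<open>entry\<close> plays the part of Choi's matrix: evaluating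
  \<open>F\<close> at this one positive matrix decides complete positivity at all levels. Both
  conditions are kernels on pairs, compared through the shuffle.\<close>

lemma completely_positive_iff_psd_theta:
  assumes F: "F \<in> carrier_mat p p" "elements_mat F \<subseteq> dual"
  shows "completely_positive (cuntz_system n S) (matrix_algebra p) (\<lambda>x. map_mat (\<lambda>f. f x) F)
    \<longleftrightarrow> psd (block_mat (n + 1) (map_mat theta F))"
proof -
  define ev where "ev = (\<lambda>x. map_mat (\<lambda>f. f x) F)"
  have Fab: "F $$ (a, b) \<in> dual" if "a < p" "b < p" for a b
    using F that by (auto simp: elements_mat_subset_iff)
  have ev: "ev x \<in> carrier_mat p p" for x using F by (simp add: ev_def)
  have lin: "linear_map (cuntz_system n S) (matrix_algebra p) ev"
    unfolding linear_map_def system_ops matrix_algebra_def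
  proof (intro conjI ballI allI; simp add: ev)
    show "ev (x + y) = ev x + ev y" if "x \<in> system" "y \<in> system" for x y
      by (rule eq_matI) (use F that Fab in \<open>auto simp: ev_def dual_space_add\<close>)
    show "ev (c *\<^sub>C x) = c \<cdot>\<^sub>m ev x" if "x \<in> system" for c x
      by (rule eq_matI) (use F that Fab in \<open>auto simp: ev_def dual_space_scaleC\<close>)
  qed
  have psd_ev: "psd (block_mat p (map_mat ev X))
      \<longleftrightarrow> pos_kernel ({..<q} \<times> {..<p}) (\<lambda>(k, a) (l, b). (F $$ (a, b)) (X $$ (k, l)))"
    if X: "X \<in> carrier_mat q q" for X q
  proof -
    have "map_mat ev X \<in> carrier_mat q q" using X by simp
    then show ?thesis
      unfolding psd_block_mat_iff[OF \<open>map_mat ev X \<in> carrier_mat q q\<close>]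
      by (intro pos_kernel_cong) (use X F in \<open>auto simp: ev_def\<close>)
  qed
  have "map_mat theta F \<in> carrier_mat p p" using F by simp
  then have "psd (block_mat (n + 1) (map_mat theta F))
      \<longleftrightarrow> pos_kernel ({..<p} \<times> {..<n + 1}) (\<lambda>(a, k) (b, l). (F $$ (a, b)) (entry k l))"
    unfolding psd_block_mat_iff[OF \<open>map_mat theta F \<in> carrier_mat p p\<close>]
    by (intro pos_kernel_cong) (use F in \<open>auto simp: theta_index\<close>)
  also have "\<dots> \<longleftrightarrow> pos_kernel ({..<n + 1} \<times> {..<p}) (\<lambda>(k, a) (l, b). (F $$ (a, b)) (entry k l))"
    by (rule pos_kernel_swap)
  also have "{..<n + 1} = {..n}" by auto
  finally have psd_theta: "psd (block_mat (n + 1) (map_mat theta F))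
      \<longleftrightarrow> pos_kernel ({..n} \<times> {..<p}) (\<lambda>(k, a) (l, b). (F $$ (a, b)) (entry k l))" .
  have "completely_positive (cuntz_system n S) (matrix_algebra p) ev
    \<longleftrightarrow> psd (block_mat (n + 1) (map_mat theta F))"
  proof
    assume cp: "completely_positive (cuntz_system n S) (matrix_algebra p) ev"
    define X where "X = mat (n + 1) (n + 1) (\<lambda>(k, l). entry k l)"
    have X: "X \<in> carrier_mat (n + 1) (n + 1)" by (simp add: X_def)
    have "map_mat ev X \<in> mcone (matrix_algebra p) (n + 1)"
      using cp entry_mat_mem_mcone by (simp add: completely_positive_def X_def)
    then have "pos_kernel ({..<n + 1} \<times> {..<p}) (\<lambda>(k, a) (l, b). (F $$ (a, b)) (X $$ (k, l)))"
      by (simp only: mcone_matrix_algebra psd_ev[OF X])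
    then have "pos_kernel ({..n} \<times> {..<p}) (\<lambda>(k, a) (l, b). (F $$ (a, b)) (entry k l))"
      unfolding \<open>{..<n + 1} = {..n}\<close>
      by (rule pos_kernel_cong[THEN iffD1, rotated]) (auto simp: X_def)
    then show "psd (block_mat (n + 1) (map_mat theta F))" by (simp only: psd_theta)
  next
    assume "psd (block_mat (n + 1) (map_mat theta F))"
    then have pos: "pos_kernel ({..n} \<times> {..<p}) (\<lambda>(k, a) (l, b). (F $$ (a, b)) (entry k l))"
      by (simp only: psd_theta)
    show "completely_positive (cuntz_system n S) (matrix_algebra p) ev"
      unfolding completely_positive_def
    proof (intro conjI allI ballI lin)
      fix q X assume "X \<in> mcone (cuntz_system n S) q"
      then obtain Y where Y: "Y \<in> carrier_mat q q" "X = Defs.adj_mat Y * Y" and sub: "elements_mat X \<subseteq> system"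
        unfolding mcone_system by blast
      have X: "X \<in> carrier_mat q q" using Y by (auto simp: Defs.adj_mat_def)
      have "pos_kernel ({..<q} \<times> {..<p}) (\<lambda>(k, a) (l, b). (F $$ (a, b)) (X $$ (k, l)))"
      proof (rule sum_adj_mult_pos_kernel[where F = "\<lambda>a b. F $$ (a, b)" and X = "\<lambda>k l. X $$ (k, l)"])
        show "X $$ (k, l) = (\<Sum>m<q. adj (Y $$ (m, k)) * Y $$ (m, l))" if "k < q" "l < q" for k l
          unfolding Y(2) by (rule adj_mat_mult_index[OF Y(1) that])
        show "X $$ (k, l) \<in> system" if "k < q" "l < q" for k l
          using sub that X by (auto simp: elements_mat_subset_iff)
      qed (use Fab pos in auto)
      then show "map_mat ev X \<in> mcone (matrix_algebra p) q"
        using X ev by (simp add: mcone_matrix_algebra psd_ev)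
    qed
  qed
  then show ?thesis by (simp only: ev_def)
qed

context
  fixes \<delta>0 :: "'a \<Rightarrow> complex" and \<delta> \<delta>s :: "nat \<Rightarrow> 'a \<Rightarrow> complex"
  assumes basis: "cuntz_dual_basis n S \<delta>0 \<delta> \<delta>s"
begin

abbreviation dual_sys :: "('a \<Rightarrow> complex) op_system" where
  "dual_sys \<equiv> dual_system (cuntz_system n S) \<delta>0"

lemma dual_sys_simps:
  "carr dual_sys = dual" "vadd dual_sys f g = (\<lambda>x\<in>system. f x + g x)"
  "vsmult dual_sys c f = (\<lambda>x\<in>system. c * f x)" "vunit dual_sys = \<delta>0"
  by (simp_all add: dual_system_def)

lemma basis_mem: "\<delta>0 \<in> dual" "i \<in> {1..n} \<Longrightarrow> \<delta> i \<in> dual" "i \<in> {1..n} \<Longrightarrow> \<delta>s i \<in> dual"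
  using basis by (auto simp: cuntz_dual_basis_def)

lemma basis_values:
  "\<delta>0 1 = 1" "j \<in> {1..n} \<Longrightarrow> \<delta>0 (S j) = 0" "j \<in> {1..n} \<Longrightarrow> \<delta>0 (adj (S j)) = 0"
  "i \<in> {1..n} \<Longrightarrow> \<delta> i 1 = 0" "i \<in> {1..n} \<Longrightarrow> \<delta>s i 1 = 0"
  "i \<in> {1..n} \<Longrightarrow> j \<in> {1..n} \<Longrightarrow> \<delta> i (S j) = (if i = j then 1 else 0)"
  "i \<in> {1..n} \<Longrightarrow> j \<in> {1..n} \<Longrightarrow> \<delta> i (adj (S j)) = 0"
  "i \<in> {1..n} \<Longrightarrow> j \<in> {1..n} \<Longrightarrow> \<delta>s i (adj (S j)) = (if i = j then 1 else 0)"
  "i \<in> {1..n} \<Longrightarrow> j \<in> {1..n} \<Longrightarrow> \<delta>s i (S j) = 0"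
  using basis by (auto simp: cuntz_dual_basis_def)

lemma theta_basis:
  "theta \<delta>0 = 1\<^sub>m (n + 1)"
  "i \<in> {1..n} \<Longrightarrow> theta (\<delta> i) = matrix_unit (n + 1) 0 i"
  "i \<in> {1..n} \<Longrightarrow> theta (\<delta>s i) = matrix_unit (n + 1) i 0"
proof -
  show "theta \<delta>0 = 1\<^sub>m (n + 1)"
    by (rule eq_matI) (auto simp: theta_def entry_def basis_values dual_space_zero[OF basis_mem(1)])
  show "theta (\<delta> i) = matrix_unit (n + 1) 0 i" if "i \<in> {1..n}"
    using that by (intro eq_matI)
      (auto simp: theta_def matrix_unit_def entry_def basis_values dual_space_zero[OF basis_mem(2)])
  show "theta (\<delta>s i) = matrix_unit (n + 1) i 0" if "i \<in> {1..n}"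
    using that by (intro eq_matI)
      (auto simp: theta_def matrix_unit_def entry_def basis_values dual_space_zero[OF basis_mem(3)])
qed

lemma theta_linear: "linear_map dual_sys (E' n) theta"
  unfolding linear_map_def by (simp add: dual_sys_simps E_ops theta_mem_E theta_plus theta_smult)

lemma theta_map_theta: "theta_map n S \<delta>0 \<delta> \<delta>s theta"
  unfolding theta_map_def using theta_linear theta_basis by blast

lemma linear_map_dual_eqI:
  assumes \<phi>: "linear_map dual_sys W \<phi>" and \<psi>: "linear_map dual_sys W \<psi>"
    and 0: "\<phi> \<delta>0 = \<psi> \<delta>0" and i: "\<And>i. i \<in> {1..n} \<Longrightarrow> \<phi> (\<delta> i) = \<psi> (\<delta> i) \<and> \<phi> (\<delta>s i) = \<psi> (\<delta>s i)"
    and f: "f \<in> dual"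
  shows "\<phi> f = \<psi> f"
proof -
  define T where "T = {g \<in> dual. \<phi> g = \<psi> g}"
  have plus: "(\<lambda>x\<in>system. g x + h x) \<in> T" if "g \<in> T" "h \<in> T" for g h
    using that \<phi> \<psi> by (auto simp: T_def linear_map_def dual_sys_simps dual_space_plus)
  have smult: "(\<lambda>x\<in>system. c * g x) \<in> T" if "g \<in> T" for g c
    using that \<phi> \<psi> by (auto simp: T_def linear_map_def dual_sys_simps dual_space_smult)
  have gen: "\<delta>0 \<in> T" "i \<in> {1..n} \<Longrightarrow> \<delta> i \<in> T" "i \<in> {1..n} \<Longrightarrow> \<delta>s i \<in> T" for i
    using 0 i basis_mem by (auto simp: T_def)
  \<comment> \<open>Partial sums of the expansion of \<open>f\<close> in the dual basis, which lets
    membership in \<open>T\<close> be reached by the binary operations of the dual.\<close>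
  define F where "F = (\<lambda>m. \<lambda>x\<in>system. f 1 * \<delta>0 x + (\<Sum>i=1..m. f (S i) * \<delta> i x + f (adj (S i)) * \<delta>s i x))"
  have F: "F m \<in> T" if "m \<le> n" for m
    using that
  proof (induction m)
    case 0
    have "F 0 = (\<lambda>x\<in>system. f 1 * \<delta>0 x)" by (auto simp: F_def)
    then show ?case using smult[OF gen(1)] by (simp only:)
  next
    case (Suc m)
    define G where "G = (\<lambda>x\<in>system. (\<lambda>x\<in>system. f (S (Suc m)) * \<delta> (Suc m) x) x
        + (\<lambda>x\<in>system. f (adj (S (Suc m))) * \<delta>s (Suc m) x) x)"
    have "G \<in> T" unfolding G_def by (intro plus smult gen) (use Suc.prems in auto)
    moreover have "F (Suc m) = (\<lambda>x\<in>system. F m x + G x)"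
      by (auto simp: F_def G_def add.assoc)
    ultimately show ?case using plus[of "F m" G] Suc by (simp only: Suc_leD)
  qed
  have "f = F n"
  proof (rule dual_space_eqI[OF f])
    show "F n \<in> dual" using F[of n] by (simp add: T_def)
    show "f x = F n x" if x: "x \<in> gens" for x
    proof -
      have one: "F n 1 = f 1" using system_gen[of 1] by (simp add: F_def basis_values)
      have "F n (S j) = f (S j)" "F n (adj (S j)) = f (adj (S j))" if j: "j \<in> {1..n}" for j
      proof -
        have "(\<Sum>i=1..n. f (S i) * \<delta> i (S j) + f (adj (S i)) * \<delta>s i (S j)) = (\<Sum>i=1..n. if i = j then f (S i) else 0)"
          by (intro sum.cong refl) (use j in \<open>auto simp: basis_values\<close>)
        then show "F n (S j) = f (S j)" using j system_gen[of "S j"] by (simp add: F_def basis_values)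
        have "(\<Sum>i=1..n. f (S i) * \<delta> i (adj (S j)) + f (adj (S i)) * \<delta>s i (adj (S j)))
            = (\<Sum>i=1..n. if i = j then f (adj (S i)) else 0)"
          by (intro sum.cong refl) (use j in \<open>auto simp: basis_values\<close>)
        then show "F n (adj (S j)) = f (adj (S j))"
          using j system_gen[of "adj (S j)"] by (simp add: F_def basis_values)
      qed
      then show ?thesis using x one by auto
    qed
  qed
  then show ?thesis using F[of n] by (simp add: T_def)
qed

text \<open>For surjectivity no dimension count is made: the image is a subspace containing the
  generators, hence contains their span.\<close>

lemma theta_bij: "bij_betw theta dual (carr (E' n))"
  unfolding bij_betw_def
proof
  show "inj_on theta dual" by (auto simp: inj_on_def theta_eq_iff)
  have "carr (E' n) \<subseteq> theta ` dual"
    unfolding E_carr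
  proof (rule span_in_least)
    show "E_gens \<subseteq> theta ` dual"
      using basis_mem theta_basis by (auto simp: image_iff) metis+
    show "subspace_of (matrix_algebra (n + 1)) (theta ` dual)"
      unfolding subspace_of_def matrix_algebra_def
    proof (intro conjI ballI allI; simp)
      show "theta ` dual \<subseteq> carrier_mat (Suc n) (Suc n)" using theta_carrier by auto
      show "dual \<noteq> {}" using basis_mem by auto
      show "x + y \<in> theta ` dual" if "x \<in> theta ` dual" "y \<in> theta ` dual" for x y
        using that dual_space_plus by (auto simp flip: theta_plus)
      show "c \<cdot>\<^sub>m x \<in> theta ` dual" if "x \<in> theta ` dual" for x c
        using that dual_space_smult by (auto simp flip: theta_smult)
    qed
  qed
  then show "theta ` dual = carr (E' n)" using theta_mem_E by auto
qed

text \<open>The cones on both sides are now the same semidefiniteness condition, so what remains is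
  transport along the bijection.\<close>

lemma mcone_dual_sys:
  "F \<in> mcone dual_sys p \<longleftrightarrow> F \<in> carrier_mat p p \<and> elements_mat F \<subseteq> dual \<and> psd (block_mat (n + 1) (map_mat theta F))"
  by (auto simp: dual_system_def completely_positive_iff_psd_theta)

lemma inv_theta_linear: "linear_map (E' n) dual_sys (inv_into dual theta)"
proof -
  have inv: "inv_into dual theta A \<in> dual" "theta (inv_into dual theta A) = A" if "A \<in> carr (E' n)" for A
    using that theta_bij by (auto simp: bij_betw_def inv_into_into f_inv_into_f)
  have inv_eq: "inv_into dual theta A = f" if "f \<in> dual" "theta f = A" for f A
    using that theta_bij by (auto simp: bij_betw_def)
  show ?thesis
    unfolding linear_map_def
  proof (intro conjI ballI allI)
    show "inv_into dual theta \<in> carr (E' n) \<rightarrow> carr dual_sys" using inv by (simp add: dual_sys_simps)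
    show "inv_into dual theta (vadd (E' n) A B) = vadd dual_sys (inv_into dual theta A) (inv_into dual theta B)"
      if "A \<in> carr (E' n)" "B \<in> carr (E' n)" for A B
      using that by (intro inv_eq) (simp_all add: dual_sys_simps E_ops inv dual_space_plus theta_plus)
    show "inv_into dual theta (vsmult (E' n) c A) = vsmult dual_sys c (inv_into dual theta A)"
      if "A \<in> carr (E' n)" for c A
      using that by (intro inv_eq) (simp_all add: dual_sys_simps E_ops inv dual_space_smult theta_smult)
  qed
qed

lemma theta_complete_order_iso: "complete_order_iso dual_sys (E' n) theta"
  unfolding complete_order_iso_def completely_positive_def dual_sys_simps E_ops
proof (intro conjI allI ballI theta_bij theta_linear inv_theta_linear theta_basis(1))
  fix p F assume "F \<in> mcone dual_sys p"
  then show "map_mat theta F \<in> mcone (E' n) p"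
    by (auto simp: mcone_dual_sys mcone_E elements_mat_subset_iff theta_mem_E)
next
  fix p A assume "A \<in> mcone (E' n) p"
  then have A: "A \<in> carrier_mat p p" "\<And>a b. a < p \<Longrightarrow> b < p \<Longrightarrow> A $$ (a, b) \<in> carr (E' n)"
    "psd (block_mat (n + 1) A)"
    by (auto simp: mcone_E)
  have inv: "inv_into dual theta B \<in> dual" "theta (inv_into dual theta B) = B" if "B \<in> carr (E' n)" for B
    using that theta_bij by (auto simp: bij_betw_def inv_into_into f_inv_into_f)
  have "map_mat theta (map_mat (inv_into dual theta) A) = A"
    by (rule eq_matI) (use A inv in auto)
  then show "map_mat (inv_into dual theta) A \<in> mcone dual_sys p"
    using A inv by (auto simp: mcone_dual_sys elements_mat_subset_iff[of _ p p])
qed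

end

end

theorem theorem5p7:
  fixes n :: nat and S :: "nat \<Rightarrow> 'a::cstar_algebra"
  assumes "2 \<le> n" and "cuntz_isometries n S"
  shows "(\<exists>\<delta>0 \<delta> \<delta>s. cuntz_dual_basis n S \<delta>0 \<delta> \<delta>s) \<and>
    (\<forall>\<delta>0 \<delta> \<delta>s. cuntz_dual_basis n S \<delta>0 \<delta> \<delta>s \<longrightarrow>
      (\<exists>\<theta>. theta_map n S \<delta>0 \<delta> \<delta>s \<theta> \<and>
           (\<forall>\<theta>'. theta_map n S \<delta>0 \<delta> \<delta>s \<theta>' \<longrightarrow>
                  (\<forall>f\<in>dual_space (cuntz_system n S). \<theta>' f = \<theta> f)) \<and>
           complete_order_iso (dual_system (cuntz_system n S) \<delta>0) (E' n) \<theta>))"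
proof -
  interpret cuntz_family n S using assms by unfold_locales
  show ?thesis
  proof (intro conjI allI impI cuntz_dual_basis_exists)
    fix \<delta>0 :: "'a \<Rightarrow> complex" and \<delta> \<delta>s :: "nat \<Rightarrow> 'a \<Rightarrow> complex"
    assume basis: "cuntz_dual_basis n S \<delta>0 \<delta> \<delta>s"
    have "\<theta>' f = theta f"
      if \<theta>': "theta_map n S \<delta>0 \<delta> \<delta>s \<theta>'" and f: "f \<in> dual_space (cuntz_system n S)" for \<theta>' f
      by (rule linear_map_dual_eqI[OF basis _ theta_linear[OF basis] _ _ f])
         (use \<theta>' theta_map_theta[OF basis] in \<open>auto simp: theta_map_def\<close>)
    then show "\<exists>\<theta>. theta_map n S \<delta>0 \<delta> \<delta>s \<theta> \<and>
        (\<forall>\<theta>'. theta_map n S \<delta>0 \<delta> \<delta>s \<theta>' \<longrightarrow> (\<forall>f\<in>dual_space (cuntz_system n S). \<theta>' f = \<theta> f)) \<and>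
        complete_order_iso (dual_system (cuntz_system n S) \<delta>0) (E' n) \<theta>"
      using theta_map_theta[OF basis] theta_complete_order_iso[OF basis] by blast
  qed
qed

end
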